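(* Let $U\subset\mathbb{R}^2$ be open with coordinates $(x,y)$, let $h:U\to\mathbb{R}$ be a smooth positive function, and let $g_\Sigma=h^2(dx^2+dy^2)$ be the corresponding Riemannian metric on $U$, with volume form $\omega_\Sigma=h^2\,dx\wedge dy$. Let $H:U\to\mathbb{R}$ be a smooth positive function satisfying $$\Delta\ln H=(\ln H)_{xx}+(\ln H)_{yy}=\tfrac12h^2+H^2\quad\text{on }U,$$ and put $l_2=(\ln H)_y$, $n_2=-(\ln H)_x$. Let $N=\{(z,t)\in\mathbb{R}^2: z<0\}$ and $M=U\times N$. Define one-forms on $M$ by $$\theta_3=\sinh z\,dt-\bigl(-\sin t\cosh z\,H(x,y)+\sinh z\,l_2(x,y)\bigr)dx-\bigl(\cos t\cosh z\,H(x,y)+\sinh z\,n_2(x,y)\bigr)dy,$$ $$\theta_4=dz-\cos t\,H(x,y)\,dx-\sin t\,H(x,y)\,dy,$$ and define the metric $g$ on $M$ by $$g(X,Y)=(\sinh\tfrac12z)^2g_\Sigma(X,Y)+\theta_3(X)\theta_3(Y)+\theta_4(X)\theta_4(Y).$$ Then: 1. $(M,g)$ admits a Kähler structure $\bar J$ with Kähler form $\bar\Omega=(\sinh\frac12z)^2\omega_\Sigma+\theta_4\wedge\theta_3$ and a Hermitian structure $J$ with Kähler form $\Omega=(\sinh\frac12z)^2\omega_\Sigma+\theta_3\wedge\theta_4$. 2. The Ricci tensor of $(M,g)$ is $J$-invariant, and $J$ is not locally conformally Kähler. 3. The Lee form of $(M,g,J)$ is $\theta=-\alpha\theta_4$,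 where $\alpha=-\coth\frac z2$.
   Context: Tensors on $U$ are pulled back to $M=U\times N$ by the projection, and $\Delta f=f_{xx}+f_{yy}$ is the flat Laplacian on $U$. An almost Hermitian structure on $(M,g)$ is an almost complex structure $J$ with $g(JX,JY)=g(X,Y)$. Its Kähler form is $\Omega(X,Y)=g(JX,Y)$. It is Hermitian if $J$ is integrable (vanishing Nijenhuis tensor), and Kähler if in addition $d\Omega=0$. The Lee form $\theta$ of a 4-dimensional Hermitian manifold $(M,g,J)$ is defined by $d\Omega=2\theta\wedge\Omega$. The structure $J$ is locally conformally Kähler if $d\theta=0$, i.e. $g$ is locally conformal to a metric which is Kähler with respect to $J$. The Ricci tensor $\rho$ is $J$-invariant if $\rho(JX,JY)=\rho(X,Y)$ for all vector fields $X,Y$. *)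

theory Defs
  imports "HOL-Analysis.Analysis"
begin

section \<open>Tensor calculus on open subsets of a Euclidean space\<close>

text \<open>
  The manifold is an open subset of a Euclidean space \<open>'a\<close>, and each tangent space is identified
  with \<open>'a\<close>. A vector field is a function \<open>'a \<Rightarrow> 'a\<close>, a one-form has type \<open>'a \<Rightarrow> 'a \<Rightarrow> real\<close> (point,
  then vector), a bilinear tensor has type \<open>'a \<Rightarrow> 'a \<Rightarrow> 'a \<Rightarrow> real\<close>, and an endomorphism field has
  type \<open>'a \<Rightarrow> 'a \<Rightarrow> 'a\<close>.
\<close>

abbreviation dir_deriv :: "('a::euclidean_space \<Rightarrow> 'b::real_normed_vector) \<Rightarrow> 'a \<Rightarrow> 'a \<Rightarrow> 'b"
  where "dir_deriv f p v \<equiv> frechet_derivative f (at p) v"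

text \<open>The next two notions are meant for open \<open>S\<close> only.\<close>

primrec Ck_on :: "nat \<Rightarrow> 'a::euclidean_space set \<Rightarrow> ('a \<Rightarrow> 'b::real_normed_vector) \<Rightarrow> bool" where
  "Ck_on 0 S f \<longleftrightarrow> continuous_on S f"
| "Ck_on (Suc k) S f \<longleftrightarrow> f differentiable_on S \<and> (\<forall>v. Ck_on k S (\<lambda>p. dir_deriv f p v))"

definition smooth_on :: "'a::euclidean_space set \<Rightarrow> ('a \<Rightarrow> 'b::real_normed_vector) \<Rightarrow> bool"
  where "smooth_on S f \<longleftrightarrow> (\<forall>k. Ck_on k S f)"

subsection \<open>Exterior algebra and exterior derivative\<close>

text \<open>
  No factorial normalisation: \<open>(\<alpha> \<and> \<beta>)(X, Y) = \<alpha>(X) \<beta>(Y) - \<alpha>(Y) \<beta>(X)\<close>. In the exterior derivatives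
  the vector arguments are extended to constant vector fields, so that no bracket terms occur.
\<close>

definition wedge11 :: "('a \<Rightarrow> real) \<Rightarrow> ('a \<Rightarrow> real) \<Rightarrow> 'a \<Rightarrow> 'a \<Rightarrow> real"
  where "wedge11 \<alpha> \<beta> X Y = \<alpha> X * \<beta> Y - \<alpha> Y * \<beta> X"

definition wedge12 :: "('a \<Rightarrow> real) \<Rightarrow> ('a \<Rightarrow> 'a \<Rightarrow> real) \<Rightarrow> 'a \<Rightarrow> 'a \<Rightarrow> 'a \<Rightarrow> real"
  where "wedge12 \<alpha> \<omega> X Y Z = \<alpha> X * \<omega> Y Z + \<alpha> Y * \<omega> Z X + \<alpha> Z * \<omega> X Y"

definition ext_deriv1 :: "('a::euclidean_space \<Rightarrow> 'a \<Rightarrow> real) \<Rightarrow> 'a \<Rightarrow> 'a \<Rightarrow> 'a \<Rightarrow> real"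
  where "ext_deriv1 \<theta> p X Y = dir_deriv (\<lambda>q. \<theta> q Y) p X - dir_deriv (\<lambda>q. \<theta> q X) p Y"

definition ext_deriv2 ::
  "('a::euclidean_space \<Rightarrow> 'a \<Rightarrow> 'a \<Rightarrow> real) \<Rightarrow> 'a \<Rightarrow> 'a \<Rightarrow> 'a \<Rightarrow> 'a \<Rightarrow> real"
  where "ext_deriv2 \<Omega> p X Y Z =
    dir_deriv (\<lambda>q. \<Omega> q Y Z) p X + dir_deriv (\<lambda>q. \<Omega> q Z X) p Y + dir_deriv (\<lambda>q. \<Omega> q X Y) p Z"

subsection \<open>Riemannian metrics, Levi-Civita connection, Ricci tensor\<close>

definition riemannian_metric_on ::
  "'a::euclidean_space set \<Rightarrow> ('a \<Rightarrow> 'a \<Rightarrow> 'a \<Rightarrow> real) \<Rightarrow> bool"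
  where "riemannian_metric_on M g \<longleftrightarrow>
    (\<forall>p\<in>M. bilinear (g p) \<and> (\<forall>X Y. g p X Y = g p Y X) \<and> (\<forall>X. X \<noteq> 0 \<longrightarrow> 0 < g p X X)) \<and>
    (\<forall>X Y. smooth_on M (\<lambda>p. g p X Y))"

definition lie_bracket :: "('a::euclidean_space \<Rightarrow> 'a) \<Rightarrow> ('a \<Rightarrow> 'a) \<Rightarrow> 'a \<Rightarrow> 'a"
  where "lie_bracket X Y p = dir_deriv Y p (X p) - dir_deriv X p (Y p)"

text \<open>
  \<open>christoffel g p X Y\<close> is the value at \<open>p\<close> of the Levi-Civita derivative of the constant vector
  field \<open>Y\<close> along \<open>X\<close>, characterised by the Koszul formula for constant fields.
\<close>

definition christoffel :: "('a::euclidean_space \<Rightarrow> 'a \<Rightarrow> 'a \<Rightarrow> real) \<Rightarrow> 'a \<Rightarrow> 'a \<Rightarrow> 'a \<Rightarrow> 'a"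
  where "christoffel g p X Y = (THE W. \<forall>Z. 2 * g p W Z =
    dir_deriv (\<lambda>q. g q Y Z) p X + dir_deriv (\<lambda>q. g q X Z) p Y - dir_deriv (\<lambda>q. g q X Y) p Z)"

definition levi_civita ::
  "('a::euclidean_space \<Rightarrow> 'a \<Rightarrow> 'a \<Rightarrow> real) \<Rightarrow> ('a \<Rightarrow> 'a) \<Rightarrow> ('a \<Rightarrow> 'a) \<Rightarrow> 'a \<Rightarrow> 'a"
  where "levi_civita g X Y p = dir_deriv Y p (X p) + christoffel g p (X p) (Y p)"

definition curvature ::
  "('a::euclidean_space \<Rightarrow> 'a \<Rightarrow> 'a \<Rightarrow> real) \<Rightarrow>
    ('a \<Rightarrow> 'a) \<Rightarrow> ('a \<Rightarrow> 'a) \<Rightarrow> ('a \<Rightarrow> 'a) \<Rightarrow> 'a \<Rightarrow> 'a"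
  where "curvature g X Y Z p =
    levi_civita g X (levi_civita g Y Z) p - levi_civita g Y (levi_civita g X Z) p
      - levi_civita g (lie_bracket X Y) Z p"

text \<open>
  \<open>\<rho>(Y, Z)\<close> is the trace of \<open>V \<mapsto> R(V, Y)Z\<close>. A trace does not depend on an inner product, so the
  standard basis and the standard inner product of \<open>'a\<close> may be used; since the curvature is
  tensorial, vectors may be extended to constant vector fields.
\<close>

definition ricci :: "('a::euclidean_space \<Rightarrow> 'a \<Rightarrow> 'a \<Rightarrow> real) \<Rightarrow> 'a \<Rightarrow> 'a \<Rightarrow> 'a \<Rightarrow> real"
  where "ricci g p Y Z = (\<Sum>b\<in>Basis. curvature g (\<lambda>_. b) (\<lambda>_. Y) (\<lambda>_. Z) p \<bullet> b)"

subsection \<open>Almost Hermitian structures\<close>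

definition nijenhuis ::
  "('a::euclidean_space \<Rightarrow> 'a \<Rightarrow> 'a) \<Rightarrow> ('a \<Rightarrow> 'a) \<Rightarrow> ('a \<Rightarrow> 'a) \<Rightarrow> 'a \<Rightarrow> 'a"
  where "nijenhuis J X Y p =
    lie_bracket (\<lambda>q. J q (X q)) (\<lambda>q. J q (Y q)) p
      - J p (lie_bracket (\<lambda>q. J q (X q)) Y p)
      - J p (lie_bracket X (\<lambda>q. J q (Y q)) p)
      - lie_bracket X Y p"

definition almost_complex_on :: "'a::euclidean_space set \<Rightarrow> ('a \<Rightarrow> 'a \<Rightarrow> 'a) \<Rightarrow> bool"
  where "almost_complex_on M J \<longleftrightarrow>
    (\<forall>p\<in>M. linear (J p) \<and> (\<forall>X. J p (J p X) = - X)) \<and> (\<forall>X. smooth_on M (\<lambda>p. J p X))"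

definition integrable_on_manifold :: "'a::euclidean_space set \<Rightarrow> ('a \<Rightarrow> 'a \<Rightarrow> 'a) \<Rightarrow> bool"
  where "integrable_on_manifold M J \<longleftrightarrow>
    (\<forall>X Y. smooth_on M X \<longrightarrow> smooth_on M Y \<longrightarrow> (\<forall>p\<in>M. nijenhuis J X Y p = 0))"

definition almost_hermitian_on ::
  "'a::euclidean_space set \<Rightarrow> ('a \<Rightarrow> 'a \<Rightarrow> 'a \<Rightarrow> real) \<Rightarrow> ('a \<Rightarrow> 'a \<Rightarrow> 'a) \<Rightarrow> bool"
  where "almost_hermitian_on M g J \<longleftrightarrow>
    riemannian_metric_on M g \<and> almost_complex_on M J \<and>
    (\<forall>p\<in>M. \<forall>X Y. g p (J p X) (J p Y) = g p X Y)"

definition kahler_form ::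
  "('a \<Rightarrow> 'a \<Rightarrow> 'a \<Rightarrow> real) \<Rightarrow> ('a \<Rightarrow> 'a \<Rightarrow> 'a) \<Rightarrow> 'a \<Rightarrow> 'a \<Rightarrow> 'a \<Rightarrow> real"
  where "kahler_form g J p X Y = g p (J p X) Y"

definition hermitian_on ::
  "'a::euclidean_space set \<Rightarrow> ('a \<Rightarrow> 'a \<Rightarrow> 'a \<Rightarrow> real) \<Rightarrow> ('a \<Rightarrow> 'a \<Rightarrow> 'a) \<Rightarrow> bool"
  where "hermitian_on M g J \<longleftrightarrow> almost_hermitian_on M g J \<and> integrable_on_manifold M J"

definition kahler_on ::
  "'a::euclidean_space set \<Rightarrow> ('a \<Rightarrow> 'a \<Rightarrow> 'a \<Rightarrow> real) \<Rightarrow> ('a \<Rightarrow> 'a \<Rightarrow> 'a) \<Rightarrow> bool"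
  where "kahler_on M g J \<longleftrightarrow> hermitian_on M g J \<and>
    (\<forall>p\<in>M. \<forall>X Y Z. ext_deriv2 (kahler_form g J) p X Y Z = 0)"

text \<open>
  For an almost Hermitian structure in dimension 4, wedging with the Kaehler form is a bijection
  from covectors to alternating 3-forms at each point, so the definite description is proper.
\<close>

definition lee_form ::
  "('a::euclidean_space \<Rightarrow> 'a \<Rightarrow> 'a \<Rightarrow> real) \<Rightarrow> ('a \<Rightarrow> 'a \<Rightarrow> 'a) \<Rightarrow> 'a \<Rightarrow> 'a \<Rightarrow> real"
  where "lee_form g J p = (THE \<theta>. linear \<theta> \<and>
    (\<forall>X Y Z. ext_deriv2 (kahler_form g J) p X Y Z = 2 * wedge12 \<theta> (kahler_form g J p) X Y Z))"

definition locally_conformally_kahler_on ::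
  "'a::euclidean_space set \<Rightarrow> ('a \<Rightarrow> 'a \<Rightarrow> 'a \<Rightarrow> real) \<Rightarrow> ('a \<Rightarrow> 'a \<Rightarrow> 'a) \<Rightarrow> bool"
  where "locally_conformally_kahler_on M g J \<longleftrightarrow> hermitian_on M g J \<and>
    (\<forall>p\<in>M. \<forall>X Y. ext_deriv1 (lee_form g J) p X Y = 0)"

definition ricci_invariant_on ::
  "'a::euclidean_space set \<Rightarrow> ('a \<Rightarrow> 'a \<Rightarrow> 'a \<Rightarrow> real) \<Rightarrow> ('a \<Rightarrow> 'a \<Rightarrow> 'a) \<Rightarrow> bool"
  where "ricci_invariant_on M g J \<longleftrightarrow>
    (\<forall>p\<in>M. \<forall>X Y. ricci g p (J p X) (J p Y) = ricci g p X Y)"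

section \<open>The metric on \<open>U \<times> N\<close>\<close>

type_synonym plane = "real \<times> real"

definition partial_x :: "(plane \<Rightarrow> real) \<Rightarrow> plane \<Rightarrow> real"
  where "partial_x f q = dir_deriv f q (1, 0)"

definition partial_y :: "(plane \<Rightarrow> real) \<Rightarrow> plane \<Rightarrow> real"
  where "partial_y f q = dir_deriv f q (0, 1)"

definition flat_laplacian :: "(plane \<Rightarrow> real) \<Rightarrow> plane \<Rightarrow> real"
  where "flat_laplacian f q = partial_x (partial_x f) q + partial_y (partial_y f) q"

definition half_plane :: "plane set"
  where "half_plane = {(z, t). z < 0}"

text \<open>Points of \<open>U \<times> N\<close> are \<open>((x, y), (z, t))\<close>; the following are the coordinate one-forms.\<close>

definition dx :: "plane \<times> plane \<Rightarrow> real" where "dx X = fst (fst X)"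
definition dy :: "plane \<times> plane \<Rightarrow> real" where "dy X = snd (fst X)"
definition dz :: "plane \<times> plane \<Rightarrow> real" where "dz X = fst (snd X)"
definition dt :: "plane \<times> plane \<Rightarrow> real" where "dt X = snd (snd X)"

definition l2 :: "(plane \<Rightarrow> real) \<Rightarrow> plane \<Rightarrow> real"
  where "l2 H q = partial_y (\<lambda>q. ln (H q)) q"

definition n2 :: "(plane \<Rightarrow> real) \<Rightarrow> plane \<Rightarrow> real"
  where "n2 H q = - partial_x (\<lambda>q. ln (H q)) q"

definition theta3 :: "(plane \<Rightarrow> real) \<Rightarrow> plane \<times> plane \<Rightarrow> plane \<times> plane \<Rightarrow> real"
  where "theta3 H = (\<lambda>((x, y), (z, t)) X.
    sinh z * dt X
    - (- sin t * cosh z * H (x, y) + sinh z * l2 H (x, y)) * dx X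
    - (cos t * cosh z * H (x, y) + sinh z * n2 H (x, y)) * dy X)"

definition theta4 :: "(plane \<Rightarrow> real) \<Rightarrow> plane \<times> plane \<Rightarrow> plane \<times> plane \<Rightarrow> real"
  where "theta4 H = (\<lambda>((x, y), (z, t)) X.
    dz X - cos t * H (x, y) * dx X - sin t * H (x, y) * dy X)"

text \<open>\<open>h\<^sup>2 (dx\<^sup>2 + dy\<^sup>2)\<close> and \<open>h\<^sup>2 dx \<and> dy\<close>, pulled back along the projection to \<open>U\<close>.\<close>

definition g_Sigma :: "(plane \<Rightarrow> real) \<Rightarrow> plane \<times> plane \<Rightarrow> plane \<times> plane \<Rightarrow> plane \<times> plane \<Rightarrow> real"
  where "g_Sigma h p X Y = (h (fst p))\<^sup>2 * (dx X * dx Y + dy X * dy Y)"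

definition omega_Sigma ::
  "(plane \<Rightarrow> real) \<Rightarrow> plane \<times> plane \<Rightarrow> plane \<times> plane \<Rightarrow> plane \<times> plane \<Rightarrow> real"
  where "omega_Sigma h p X Y = (h (fst p))\<^sup>2 * wedge11 dx dy X Y"

definition sinh_half_sq :: "plane \<times> plane \<Rightarrow> real"
  where "sinh_half_sq = (\<lambda>(_, (z, t)). (sinh (z / 2))\<^sup>2)"

definition metric_g ::
  "(plane \<Rightarrow> real) \<Rightarrow> (plane \<Rightarrow> real) \<Rightarrow> plane \<times> plane \<Rightarrow> plane \<times> plane \<Rightarrow> plane \<times> plane \<Rightarrow> real"
  where "metric_g h H p X Y =
    sinh_half_sq p * g_Sigma h p X Y + theta3 H p X * theta3 H p Y + theta4 H p X * theta4 H p Y"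

definition Omega_bar ::
  "(plane \<Rightarrow> real) \<Rightarrow> (plane \<Rightarrow> real) \<Rightarrow> plane \<times> plane \<Rightarrow> plane \<times> plane \<Rightarrow> plane \<times> plane \<Rightarrow> real"
  where "Omega_bar h H p X Y =
    sinh_half_sq p * omega_Sigma h p X Y + wedge11 (theta4 H p) (theta3 H p) X Y"

definition Omega ::
  "(plane \<Rightarrow> real) \<Rightarrow> (plane \<Rightarrow> real) \<Rightarrow> plane \<times> plane \<Rightarrow> plane \<times> plane \<Rightarrow> plane \<times> plane \<Rightarrow> real"
  where "Omega h H p X Y =
    sinh_half_sq p * omega_Sigma h p X Y + wedge11 (theta3 H p) (theta4 H p) X Y"

text \<open>\<open>- coth (z/2)\<close>, written out because there is no \<open>coth\<close> in the library.\<close>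

definition alpha :: "plane \<times> plane \<Rightarrow> real"
  where "alpha = (\<lambda>(_, (z, t)). - (cosh (z / 2) / sinh (z / 2)))"

end

theory Submission
  imports Defs
begin

text \<open>
Write \<open>s = sinh (z/2)\<close> and \<open>c = cosh (z/2)\<close>. The metric is the sum of the squares of the coframe
\<open>e\<^sub>1 = s h dx\<close>, \<open>e\<^sub>2 = s h dy\<close>, \<open>e\<^sub>3 = \<theta>\<^sub>3\<close>, \<open>e\<^sub>4 = \<theta>\<^sub>4\<close>. All calculations go through three one-forms,
\<open>A = H (cos t dx + sin t dy)\<close>, \<open>B = H (- sin t dx + cos t dy)\<close> and
\<open>\<tau> = dt - (ln H)\<^sub>y dx + (ln H)\<^sub>x dy\<close>,
in terms of which \<open>\<theta>\<^sub>4 = dz - A\<close> and \<open>\<theta>\<^sub>3 = sinh z \<tau> - cosh z B\<close>. The correction of \<open>dt\<close> in \<open>\<tau>\<close>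
absorbs the derivatives of \<open>H\<close>: one has \<open>dA = \<tau> \<and> B\<close>, \<open>dB = - \<tau> \<and> A\<close>,
\<open>d\<tau> = (\<Delta> ln H) dx \<and> dy\<close> and \<open>A \<and> B = H\<^sup>2 dx \<and> dy\<close>. The partial differential equation
enters as \<open>\<Delta> ln H - H\<^sup>2 = h\<^sup>2/2\<close>.

This is the value for which \<open>d(\<theta>\<^sub>3 \<and> \<theta>\<^sub>4)\<close> equals \<open>d(e\<^sub>1 \<and> e\<^sub>2)\<close>, both being
\<open>(1/2) sinh z h\<^sup>2 dz \<and> dx \<and> dy\<close> (\<open>ext_deriv2_base\<close>, \<open>ext_deriv2_fiber\<close>). Hence
\<open>e\<^sub>1 \<and> e\<^sub>2 - \<theta>\<^sub>3 \<and> \<theta>\<^sub>4\<close> is closed, while the differential of \<open>\<Omega> = e\<^sub>1 \<and> e\<^sub>2 + \<theta>\<^sub>3 \<and> \<theta>\<^sub>4\<close> is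
\<open>2 coth (z/2) \<theta>\<^sub>4 \<and> \<Omega>\<close>, which gives the Lee form (\<open>lee_form_eq\<close>). The differential of the Lee form
contains the term \<open>- coth (z/2) \<tau> \<and> B\<close>, which does not vanish because \<open>H\<close> does not.

Both almost complex structures, \<open>complex_structure \<sigma>\<close> with \<open>\<sigma> = 1\<close> for \<open>J\<close> and \<open>\<sigma> = -1\<close> for \<open>J_bar\<close>, are
integrable because \<open>dx + i dy\<close> is closed and the differential of \<open>\<theta>\<^sub>3 + i \<sigma> \<theta>\<^sub>4\<close> lies in the ideal
generated by the two forms (\<open>form_nijenhuis\<close>, \<open>nijenhuis_zero\<close>).

For the Ricci tensor, Cartan's structure equations express the Levi-Civita connection and its curvature
as defined by the Koszul formula through the coframe (\<open>christoffel_frame\<close>, \<open>curvature_frame\<close>,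
\<open>ricci_frame\<close>). The connection matrix commutes with the Kaehler structure, and the entries of the
curvature matrix are combinations of the \<open>e\<^sub>i \<and> e\<^sub>j\<close> in which all coefficients are constant except that of
\<open>e\<^sub>1 \<and> e\<^sub>2\<close> in the entry \<open>(1, 2)\<close> (\<open>structure_equations\<close>, \<open>curvature_equations\<close>). So the Ricci tensor is
diagonal, with one eigenvalue on \<open>e\<^sub>1, e\<^sub>2\<close> and the eigenvalue \<open>-3/2\<close> on \<open>\<theta>\<^sub>3, \<theta>\<^sub>4\<close>; such a
tensor is invariant under both structures.
\<close>

section \<open>Calculus of smooth functions\<close>

lemma dir_deriv_eqI: "(f has_derivative f') (at p) \<Longrightarrow> dir_deriv f p = f'"
  by (metis frechet_derivative_at)

text \<open>
The directional derivative is chosen among all functions that satisfy the defining property, so it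
depends only on the germ of the function, even where the function is not differentiable.
\<close>

lemma dir_deriv_cong:
  assumes "open S" "p \<in> S" "\<And>q. q \<in> S \<Longrightarrow> f q = g q"
  shows "dir_deriv f p = dir_deriv g p"
proof -
  have "(f has_derivative D) (at p) \<longleftrightarrow> (g has_derivative D) (at p)" for D
    using has_derivative_transform_within_open[of f D p UNIV S g]
      has_derivative_transform_within_open[of g D p UNIV S f] assms by auto
  then show ?thesis by (simp add: frechet_derivative_def)
qed

lemma differentiable_imp_has_derivative:
  "f differentiable (at p) \<Longrightarrow> (f has_derivative dir_deriv f p) (at p)"
  by (simp add: frechet_derivative_works)

lemma Ck_on_Suc_differentiable:
  assumes "Ck_on (Suc k) S f" "open S" "p \<in> S"
  shows "f differentiable (at p)"
  using assms by (simp add: differentiable_on_eq_differentiable_at)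

lemma Ck_on_cong:
  assumes "open S" "\<And>q. q \<in> S \<Longrightarrow> f q = g q" "Ck_on k S f"
  shows "Ck_on k S g"
  using assms(2,3)
proof (induction k arbitrary: f g)
  case 0
  then show ?case using continuous_on_cong[of S S f g] by simp
next
  case (Suc k)
  have "g differentiable (at p)" if "p \<in> S" for p
    using has_derivative_transform_within_open[OF differentiable_imp_has_derivative[OF
          Ck_on_Suc_differentiable[OF Suc.prems(2) assms(1) that]] assms(1) that] Suc.prems(1)
      differentiableI by blast
  moreover have "Ck_on k S (\<lambda>p. dir_deriv g p v)" for v
    by (rule Suc.IH[of "\<lambda>p. dir_deriv f p v"])
       (use Suc.prems dir_deriv_cong[OF assms(1), of _ f g] in auto)
  ultimately show ?case by (simp add: differentiable_on_eq_differentiable_at assms(1))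
qed

lemma Ck_on_SucI:
  assumes "open S" "\<And>p. p \<in> S \<Longrightarrow> (f has_derivative f' p) (at p)"
    and "\<And>v. Ck_on k S (\<lambda>p. f' p v)"
  shows "Ck_on (Suc k) S f"
proof -
  have "f differentiable_on S"
    using assms(1,2) differentiableI by (simp add: differentiable_on_eq_differentiable_at) blast
  moreover have "Ck_on k S (\<lambda>p. dir_deriv f p v)" for v
    by (rule Ck_on_cong[OF assms(1) _ assms(3)]) (simp add: dir_deriv_eqI[OF assms(2)])
  ultimately show ?thesis by simp
qed

lemma Ck_on_Suc_has_derivative:
  assumes "Ck_on (Suc k) S f" "open S" "p \<in> S"
  shows "(f has_derivative dir_deriv f p) (at p)"
  using Ck_on_Suc_differentiable[OF assms] by (rule differentiable_imp_has_derivative)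

lemma Ck_on_Suc_imp: "Ck_on (Suc k) S f \<Longrightarrow> Ck_on k S f"
  by (induction k arbitrary: f) (auto simp: differentiable_imp_continuous_on)

lemma Ck_on_const: "Ck_on k S (\<lambda>_. c)"
  by (induction k arbitrary: c) auto

lemma Ck_on_add:
  fixes f g :: "'a::euclidean_space \<Rightarrow> 'b::real_normed_vector"
  assumes "open S" "Ck_on k S f" "Ck_on k S g"
  shows "Ck_on k S (\<lambda>p. f p + g p)"
  using assms(2,3)
proof (induction k arbitrary: f g)
  case 0
  then show ?case by (simp add: continuous_on_add)
next
  case (Suc k)
  show ?case
    using Suc assms(1)
    by (intro Ck_on_SucI[where f' = "\<lambda>p v. dir_deriv f p v + dir_deriv g p v"])
       (auto intro!: has_derivative_add Ck_on_Suc_has_derivative simp del: Ck_on.simps,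
        auto)
qed

lemma Ck_on_scaleR:
  fixes f :: "'a::euclidean_space \<Rightarrow> real" and g :: "'a \<Rightarrow> 'b::real_normed_vector"
  assumes "open S" "Ck_on k S f" "Ck_on k S g"
  shows "Ck_on k S (\<lambda>p. f p *\<^sub>R g p)"
  using assms(2,3)
proof (induction k arbitrary: f g)
  case 0
  then show ?case by (simp add: continuous_on_scaleR)
next
  case (Suc k)
  have "Ck_on k S (\<lambda>p. f p *\<^sub>R dir_deriv g p v + dir_deriv f p v *\<^sub>R g p)" for v
    using Suc.prems by (intro Ck_on_add assms(1) Suc.IH Ck_on_Suc_imp[OF Suc.prems(1)]
        Ck_on_Suc_imp[OF Suc.prems(2)]) auto
  then show ?case
    using Suc.prems assms(1)
    by (intro Ck_on_SucI[where f' = "\<lambda>p v. f p *\<^sub>R dir_deriv g p v + dir_deriv f p v *\<^sub>R g p"])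
       (auto intro!: has_derivative_scaleR Ck_on_Suc_has_derivative simp del: Ck_on.simps)
qed

lemma Ck_on_mult:
  fixes f g :: "'a::euclidean_space \<Rightarrow> real"
  assumes "open S" "Ck_on k S f" "Ck_on k S g"
  shows "Ck_on k S (\<lambda>p. f p * g p)"
  using Ck_on_scaleR[OF assms] by simp

lemma Ck_on_bounded_linear:
  assumes "open S" "bounded_linear T" "Ck_on k S f"
  shows "Ck_on k S (\<lambda>p. T (f p))"
  using assms(3)
proof (induction k arbitrary: f)
  case 0
  then show ?case
    by (simp add: bounded_linear.continuous_on[OF assms(2)])
next
  case (Suc k)
  show ?case
  proof (rule Ck_on_SucI[where f' = "\<lambda>p v. T (dir_deriv f p v)"])
    show "((\<lambda>p. T (f p)) has_derivative (\<lambda>v. T (dir_deriv f p v))) (at p)" if "p \<in> S" for p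
      using bounded_linear.has_derivative[OF assms(2) Ck_on_Suc_has_derivative] Suc.prems assms(1)
        that by blast
    show "Ck_on k S (\<lambda>p. T (dir_deriv f p v))" for v
      using Suc.IH Suc.prems by auto
  qed (rule assms(1))
qed

lemma Ck_on_linear:
  fixes T :: "'a::euclidean_space \<Rightarrow> 'b::real_normed_vector"
  assumes "open S" "bounded_linear T"
  shows "Ck_on k S T"
proof (cases k)
  case 0
  then show ?thesis using assms linear_continuous_on by auto
next
  case (Suc j)
  show ?thesis unfolding Suc
    by (rule Ck_on_SucI[where f' = "\<lambda>_. T"])
       (auto intro: assms bounded_linear_imp_has_derivative Ck_on_const)
qed

text \<open>
  The derivative of \<open>\<phi> \<circ> f\<close> is \<open>(\<phi>' \<circ> f) df\<close>, so a class of outer functions that is closed under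
  differentiation composes with smooth functions.
\<close>

lemma Ck_on_compose_real_family:
  fixes f :: "'a::euclidean_space \<Rightarrow> real" and \<phi> :: "'i \<Rightarrow> real \<Rightarrow> real"
  assumes "open S" "f ` S \<subseteq> T"
    and deriv: "\<And>i x. x \<in> T \<Longrightarrow> (\<phi> i has_real_derivative \<phi> (\<delta> i) x) (at x)"
    and "Ck_on k S f"
  shows "Ck_on k S (\<lambda>p. \<phi> i (f p))"
  using assms(4)
proof (induction k arbitrary: i)
  case 0
  have "continuous_on T (\<phi> i)"
    by (intro continuous_at_imp_continuous_on ballI DERIV_isCont) (rule deriv)
  with 0 assms(2) show ?case
    by (auto intro: continuous_on_compose2)
next
  case (Suc k)
  show ?case
  proof (rule Ck_on_SucI[where f' = "\<lambda>p v. \<phi> (\<delta> i) (f p) * dir_deriv f p v"])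
    fix p assume "p \<in> S"
    have "(\<phi> i has_derivative (*) (\<phi> (\<delta> i) (f p))) (at (f p))"
      using deriv[of "f p" i] \<open>p \<in> S\<close> assms(2) by (auto simp: has_field_derivative_def)
    then show "((\<lambda>p. \<phi> i (f p)) has_derivative (\<lambda>v. \<phi> (\<delta> i) (f p) * dir_deriv f p v)) (at p)"
      using diff_chain_at[OF Ck_on_Suc_has_derivative[OF Suc.prems assms(1) \<open>p \<in> S\<close>]]
      by (simp add: o_def)
  next
    show "Ck_on k S (\<lambda>p. \<phi> (\<delta> i) (f p) * dir_deriv f p v)" for v
      using Suc by (intro Ck_on_mult assms(1) Suc.IH Ck_on_Suc_imp[OF Suc.prems]) auto
  qed (rule assms(1))
qed

text \<open>
The derivative of \<open>1/f\<close> is \<open>- (1/f) df (1/f)\<close>, which again contains \<open>1/f\<close> but one derivative of \<open>f\<close>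
more, so the induction is on the order of differentiability with \<open>f\<close> fixed.
\<close>

lemma Ck_on_inverse:
  fixes f :: "'a::euclidean_space \<Rightarrow> real"
  assumes "open S" "\<And>p. p \<in> S \<Longrightarrow> f p \<noteq> 0" "Ck_on k S f"
  shows "Ck_on k S (\<lambda>p. inverse (f p))"
  using assms(3)
proof (induction k)
  case 0
  then show ?case using assms(2) by (auto intro: continuous_on_inverse)
next
  case (Suc k)
  have inv: "Ck_on k S (\<lambda>p. inverse (f p))"
    using Suc.IH Suc.prems Ck_on_Suc_imp by blast
  show ?case
  proof (rule Ck_on_SucI[where f' = "\<lambda>p v. - 1 * (inverse (f p) * dir_deriv f p v * inverse (f p))"])
    fix p assume "p \<in> S"
    then show "((\<lambda>p. inverse (f p)) has_derivative
        (\<lambda>v. - 1 * (inverse (f p) * dir_deriv f p v * inverse (f p)))) (at p)"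
      using Ck_on_Suc_has_derivative[OF Suc.prems assms(1)] assms(2)
      by (auto intro!: derivative_eq_intros)
  next
    show "Ck_on k S (\<lambda>p. - 1 * (inverse (f p) * dir_deriv f p v * inverse (f p)))" for v
      using Suc.prems by (intro Ck_on_mult Ck_on_const assms(1) inv) auto
  qed (rule assms(1))
qed

lemma Ck_on_ln:
  fixes f :: "'a::euclidean_space \<Rightarrow> real"
  assumes "open S" "\<And>p. p \<in> S \<Longrightarrow> 0 < f p" "Ck_on k S f"
  shows "Ck_on k S (\<lambda>p. ln (f p))"
proof (cases k)
  case 0
  then show ?thesis using assms by (force intro: continuous_on_ln)
next
  case (Suc j)
  show ?thesis unfolding Suc
  proof (rule Ck_on_SucI[where f' = "\<lambda>p v. inverse (f p) * dir_deriv f p v"])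
    fix p assume "p \<in> S"
    then show "((\<lambda>p. ln (f p)) has_derivative (\<lambda>v. inverse (f p) * dir_deriv f p v)) (at p)"
      using Ck_on_Suc_has_derivative[OF assms(3)[unfolded Suc] assms(1)] assms(2)
      by (auto intro!: derivative_eq_intros simp: field_simps)
  next
    have "Ck_on j S f" "Ck_on j S (\<lambda>p. dir_deriv f p v)" for v
      using assms(3) unfolding Suc by (blast intro: Ck_on_Suc_imp, simp)
    then show "Ck_on j S (\<lambda>p. inverse (f p) * dir_deriv f p v)" for v
      using assms(2) by (intro Ck_on_mult Ck_on_inverse assms(1)) fastforce+
  qed (rule assms(1))
qed

lemma Ck_on_fst:
  fixes f :: "'a::euclidean_space \<Rightarrow> 'c::real_normed_vector"
    and V :: "'b::euclidean_space set"
  assumes "open U" "open V" "Ck_on k U f"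
  shows "Ck_on k (U \<times> V) (\<lambda>p. f (fst p))"
  using assms(3)
proof (induction k arbitrary: f)
  case 0
  then show ?case
    by (auto intro!: continuous_on_compose2[of U f "U \<times> V" fst] continuous_intros)
next
  case (Suc k)
  show ?case
  proof (rule Ck_on_SucI[where f' = "\<lambda>p v. dir_deriv f (fst p) (fst v)"])
    fix p assume "p \<in> U \<times> V"
    then have "(f has_derivative dir_deriv f (fst p)) (at (fst p))"
      using Ck_on_Suc_has_derivative[OF Suc.prems assms(1)] by auto
    from diff_chain_at[OF has_derivative_fst[OF has_derivative_ident] this]
    show "((\<lambda>p. f (fst p)) has_derivative (\<lambda>v. dir_deriv f (fst p) (fst v))) (at p)"
      by (simp add: o_def)
  qed (use Suc assms in \<open>auto simp: open_Times\<close>)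
qed

lemma smooth_on_const: "smooth_on S (\<lambda>_. c)"
  and smooth_on_add: "open S \<Longrightarrow> smooth_on S f \<Longrightarrow> smooth_on S g \<Longrightarrow> smooth_on S (\<lambda>p. f p + g p)"
  and smooth_on_bounded_linear:
    "open S \<Longrightarrow> bounded_linear T \<Longrightarrow> smooth_on S f \<Longrightarrow> smooth_on S (\<lambda>p. T (f p))"
  and smooth_on_linear: "open S \<Longrightarrow> bounded_linear A \<Longrightarrow> smooth_on S A"
  unfolding smooth_on_def
  by (blast intro: Ck_on_const Ck_on_add Ck_on_bounded_linear Ck_on_linear)+

lemma smooth_on_mult:
    "open S \<Longrightarrow> smooth_on S a \<Longrightarrow> smooth_on S b \<Longrightarrow> smooth_on S (\<lambda>p. a p * b p)"
  and smooth_on_inverse: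
    "open S \<Longrightarrow> (\<And>p. p \<in> S \<Longrightarrow> a p \<noteq> 0) \<Longrightarrow> smooth_on S a \<Longrightarrow> smooth_on S (\<lambda>p. inverse (a p))"
  and smooth_on_ln:
    "open S \<Longrightarrow> (\<And>p. p \<in> S \<Longrightarrow> 0 < a p) \<Longrightarrow> smooth_on S a \<Longrightarrow> smooth_on S (\<lambda>p. ln (a p))"
  for a b :: "'a::euclidean_space \<Rightarrow> real"
  unfolding smooth_on_def by (blast intro: Ck_on_mult Ck_on_inverse Ck_on_ln)+

lemma smooth_on_fst:
  "open U \<Longrightarrow> open V \<Longrightarrow> smooth_on U f \<Longrightarrow> smooth_on (U \<times> V) (\<lambda>p. f (fst p))"
  unfolding smooth_on_def using Ck_on_fst by blast

lemma smooth_on_dir_deriv: "smooth_on S f \<Longrightarrow> smooth_on S (\<lambda>p. dir_deriv f p v)"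
  unfolding smooth_on_def by (metis Ck_on.simps(2))

lemma smooth_on_differentiable:
  "smooth_on S f \<Longrightarrow> open S \<Longrightarrow> p \<in> S \<Longrightarrow> f differentiable (at p)"
  unfolding smooth_on_def using Ck_on_Suc_differentiable by blast

lemma smooth_on_has_derivative:
  "smooth_on S f \<Longrightarrow> open S \<Longrightarrow> p \<in> S \<Longrightarrow> (f has_derivative dir_deriv f p) (at p)"
  using smooth_on_differentiable differentiable_imp_has_derivative by blast

lemma smooth_on_continuous: "smooth_on S f \<Longrightarrow> continuous_on S f"
  unfolding smooth_on_def by (metis Ck_on.simps(1))

lemma smooth_on_uminus: "open S \<Longrightarrow> smooth_on S f \<Longrightarrow> smooth_on S (\<lambda>p. - f p)"
  by (rule smooth_on_bounded_linear[OF _ bounded_linear_minus[OF bounded_linear_ident]])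

lemma smooth_on_diff:
  "open S \<Longrightarrow> smooth_on S f \<Longrightarrow> smooth_on S g \<Longrightarrow> smooth_on S (\<lambda>p. f p - g p)"
  using smooth_on_add[of S f "\<lambda>p. - g p"] smooth_on_uminus[of S g] by simp

lemma smooth_on_scaleR:
  "open S \<Longrightarrow> smooth_on S a \<Longrightarrow> smooth_on S V \<Longrightarrow> smooth_on S (\<lambda>p. a p *\<^sub>R V p)"
  unfolding smooth_on_def by (blast intro: Ck_on_scaleR)

lemma smooth_on_sinh: "smooth_on S (\<lambda>p. sinh (a p))"
  and smooth_on_cosh: "smooth_on S (\<lambda>p. cosh (a p))"
  and smooth_on_sin: "smooth_on S (\<lambda>p. sin (a p))"
  and smooth_on_cos: "smooth_on S (\<lambda>p. cos (a p))"
  if "open S" "smooth_on S a" for a :: "'a::euclidean_space \<Rightarrow> real"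
proof -
  have hyp: "Ck_on k S (\<lambda>p. (if b then sinh else cosh) (a p))" for k b
  proof (rule Ck_on_compose_real_family[where T = UNIV and \<phi> = "\<lambda>b. if b then sinh else cosh"
        and \<delta> = Not])
    show "((if i then sinh else cosh) has_real_derivative (if \<not> i then sinh else cosh) x) (at x)"
      for i and x :: real
      by (auto intro!: derivative_eq_intros)
  qed (use that in \<open>auto simp: smooth_on_def\<close>)
  from hyp[of _ True] hyp[of _ False]
  show "smooth_on S (\<lambda>p. sinh (a p))" "smooth_on S (\<lambda>p. cosh (a p))"
    by (simp_all add: smooth_on_def)
  \<comment> \<open>\<open>sin (x + n\<pi>/2)\<close> runs through the derivatives of the sine.\<close>
  have fam: "Ck_on k S (\<lambda>p. sin (a p + real n * (pi / 2)))" for k n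
  proof (rule Ck_on_compose_real_family[where T = UNIV and
        \<phi> = "\<lambda>n x. sin (x + real n * (pi / 2))" and \<delta> = Suc])
    show "((\<lambda>x. sin (x + real i * (pi / 2))) has_real_derivative
        sin (x + real (Suc i) * (pi / 2))) (at x)" for i x
    proof -
      have "x + real (Suc i) * (pi / 2) = (x + real i * (pi / 2)) + pi / 2"
        by (simp add: field_simps)
      then have "sin (x + real (Suc i) * (pi / 2)) = cos (x + real i * (pi / 2))"
        by (simp only: sin_add[of _ "pi / 2"] sin_pi_half cos_pi_half mult_1_right mult_zero_right add_0)
      then show ?thesis by (auto intro!: derivative_eq_intros)
    qed
  qed (use that in \<open>auto simp: smooth_on_def\<close>)
  from fam[of _ 0] fam[of _ 1]
  show "smooth_on S (\<lambda>p. sin (a p))" "smooth_on S (\<lambda>p. cos (a p))"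
    by (simp_all add: smooth_on_def sin_add)
qed

subsection \<open>Symmetry of the second derivative\<close>

lemma has_derivative_line:
  assumes "(f has_derivative f') (at (q + \<xi> *\<^sub>R u))"
  shows "((\<lambda>\<sigma>. f (q + \<sigma> *\<^sub>R u)) has_real_derivative f' u) (at \<xi>)"
proof -
  interpret f': bounded_linear f' using assms by (rule has_derivative_bounded_linear)
  have "((\<lambda>\<sigma>. q + \<sigma> *\<^sub>R u) has_derivative (\<lambda>\<sigma>. \<sigma> *\<^sub>R u)) (at \<xi>)"
    by (auto intro!: derivative_eq_intros)
  from diff_chain_at[OF this assms] show ?thesis
    by (simp add: o_def has_field_derivative_def f'.scaleR mult_commute_abs)
qed

text \<open>
  Two applications of the mean value theorem, first along \<open>u\<close> and then along \<open>v\<close>, turn the second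
  difference of \<open>f\<close>, which is symmetric in \<open>u\<close> and \<open>v\<close>, into a mixed second derivative near \<open>p\<close>.
\<close>

lemma second_difference_mvt:
  fixes f :: "'a::euclidean_space \<Rightarrow> real"
  assumes f: "\<And>q. q \<in> ball p r \<Longrightarrow> f differentiable (at q)"
    and df: "\<And>q. q \<in> ball p r \<Longrightarrow> (\<lambda>q. dir_deriv f q u) differentiable (at q)"
    and e: "0 < e" "e * (norm u + norm v) < r"
  obtains q where "norm (q - p) \<le> e * (norm u + norm v)"
    "f (p + e *\<^sub>R u + e *\<^sub>R v) - f (p + e *\<^sub>R u) - f (p + e *\<^sub>R v) + f p
      = e\<^sup>2 * dir_deriv (\<lambda>q. dir_deriv f q u) q v"
proof -
  have near: "norm (a *\<^sub>R u + b *\<^sub>R v) \<le> e * (norm u + norm v)"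
    if "0 \<le> a" "a \<le> e" "0 \<le> b" "b \<le> e" for a b
  proof -
    have "norm (a *\<^sub>R u + b *\<^sub>R v) \<le> a * norm u + b * norm v"
      using norm_triangle_ineq[of "a *\<^sub>R u" "b *\<^sub>R v"] that by simp
    also have "\<dots> \<le> e * norm u + e * norm v"
      using that by (intro add_mono mult_right_mono) auto
    finally show ?thesis by (simp add: algebra_simps)
  qed
  have inball: "p + a *\<^sub>R u + b *\<^sub>R v \<in> ball p r"
    if "0 \<le> a" "a \<le> e" "0 \<le> b" "b \<le> e" for a b
    using near[OF that] e(2) unfolding mem_ball dist_norm norm_minus_commute[of p]
    by (simp add: algebra_simps)
  define G where "G a = f ((p + e *\<^sub>R v) + a *\<^sub>R u) - f (p + a *\<^sub>R u)" for a
  have "(G has_real_derivative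
      dir_deriv f (p + e *\<^sub>R v + a *\<^sub>R u) u - dir_deriv f (p + a *\<^sub>R u) u) (at a)"
    if "0 \<le> a" "a \<le> e" for a
    unfolding G_def using inball[of a e] inball[of a 0] that e(1)
    by (intro DERIV_diff has_derivative_line differentiable_imp_has_derivative f)
       (auto simp: algebra_simps)
  then obtain a where a: "0 < a" "a < e" and Ga: "G e - G 0 =
      e * (dir_deriv f (p + e *\<^sub>R v + a *\<^sub>R u) u - dir_deriv f (p + a *\<^sub>R u) u)"
    using MVT2[of 0 e G "\<lambda>a. dir_deriv f (p + e *\<^sub>R v + a *\<^sub>R u) u - dir_deriv f (p + a *\<^sub>R u) u"]
      e(1) by auto
  have "((\<lambda>b. dir_deriv f ((p + a *\<^sub>R u) + b *\<^sub>R v) u) has_real_derivative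
      dir_deriv (\<lambda>q. dir_deriv f q u) (p + a *\<^sub>R u + b *\<^sub>R v) v) (at b)"
    if "0 \<le> b" "b \<le> e" for b
    using inball[of a b] that a
    by (intro has_derivative_line[where f = "\<lambda>q. dir_deriv f q u"]
        differentiable_imp_has_derivative df) auto
  then obtain b where b: "0 < b" "b < e" and
    "dir_deriv f ((p + a *\<^sub>R u) + e *\<^sub>R v) u - dir_deriv f ((p + a *\<^sub>R u) + 0 *\<^sub>R v) u =
      e * dir_deriv (\<lambda>q. dir_deriv f q u) (p + a *\<^sub>R u + b *\<^sub>R v) v"
    using MVT2[of 0 e "\<lambda>b. dir_deriv f ((p + a *\<^sub>R u) + b *\<^sub>R v) u"
        "\<lambda>b. dir_deriv (\<lambda>q. dir_deriv f q u) (p + a *\<^sub>R u + b *\<^sub>R v) v"] e(1) by auto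
  with Ga have "G e - G 0 = e\<^sup>2 * dir_deriv (\<lambda>q. dir_deriv f q u) (p + a *\<^sub>R u + b *\<^sub>R v) v"
    by (simp add: power2_eq_square algebra_simps)
  then show ?thesis
    using near[of a b] a b
    by (intro that[of "p + a *\<^sub>R u + b *\<^sub>R v"]) (auto simp: G_def algebra_simps)
qed

text \<open>
The second difference with step \<open>e\<close>, divided by \<open>e\<^sup>2\<close>, tends to both mixed second derivatives.
\<close>

theorem dir_deriv_commute:
  fixes f :: "'a::euclidean_space \<Rightarrow> real"
  assumes "open S" "p \<in> S" "smooth_on S f"
  shows "dir_deriv (\<lambda>q. dir_deriv f q u) p v = dir_deriv (\<lambda>q. dir_deriv f q v) p u"
proof -
  define F where "F u v q = dir_deriv (\<lambda>q. dir_deriv f q u) q v" for u v q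
  have F: "isCont (F u v) p" for u v
    using smooth_on_continuous[OF smooth_on_dir_deriv[OF smooth_on_dir_deriv[OF assms(3)]]] assms
    unfolding F_def by (simp add: continuous_on_eq_continuous_at)
  obtain r where r: "0 < r" "ball p r \<subseteq> S"
    using assms(1,2) open_contains_ball by blast
  define \<Delta> where
    "\<Delta> e = f (p + e *\<^sub>R u + e *\<^sub>R v) - f (p + e *\<^sub>R u) - f (p + e *\<^sub>R v) + f p" for e
  \<comment> \<open>The summand 1 keeps the bound meaningful for \<open>u = v = 0\<close>.\<close>
  define K where "K = norm u + norm v + 1"
  have K: "0 < K" by (simp add: K_def add_nonneg_pos)
  have near: "\<bar>\<Delta> e / e\<^sup>2 - F u' v' p\<bar> < \<epsilon>"
    if uv: "u' = u \<and> v' = v \<or> u' = v \<and> v' = u" and "0 < e" "e * K < r"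
      and d: "\<And>q. norm (q - p) < e * K \<Longrightarrow> \<bar>F u' v' q - F u' v' p\<bar> < \<epsilon>" for u' v' e \<epsilon>
  proof -
    have lt: "e * (norm u' + norm v') < e * K"
      using uv \<open>0 < e\<close> by (auto simp: K_def)
    have "e * (norm u' + norm v') < r"
      using lt \<open>e * K < r\<close> by linarith
    obtain q where q: "norm (q - p) \<le> e * (norm u' + norm v')"
      "f (p + e *\<^sub>R u' + e *\<^sub>R v') - f (p + e *\<^sub>R u') - f (p + e *\<^sub>R v') + f p = e\<^sup>2 * F u' v' q"
      unfolding F_def
      by (rule second_difference_mvt[of p r f u' e v'])
         (use r assms \<open>0 < e\<close> \<open>e * (norm u' + norm v') < r\<close> in
           \<open>auto intro!: smooth_on_differentiable[of S] smooth_on_dir_deriv\<close>)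
    have "\<Delta> e = e\<^sup>2 * F u' v' q"
      using q(2) uv by (auto simp: \<Delta>_def algebra_simps)
    then show ?thesis using d[of q] q(1) lt \<open>0 < e\<close> by simp
  qed
  have "\<bar>F u v p - F v u p\<bar> < \<epsilon>" if "0 < \<epsilon>" for \<epsilon>
  proof -
    obtain d1 where d1: "0 < d1" "\<And>q. norm (q - p) < d1 \<Longrightarrow> \<bar>F u v q - F u v p\<bar> < \<epsilon> / 2"
      using F[of u v] \<open>0 < \<epsilon>\<close> unfolding continuous_at_eps_delta dist_norm real_norm_def
      by (meson half_gt_zero)
    obtain d2 where d2: "0 < d2" "\<And>q. norm (q - p) < d2 \<Longrightarrow> \<bar>F v u q - F v u p\<bar> < \<epsilon> / 2"
      using F[of v u] \<open>0 < \<epsilon>\<close> unfolding continuous_at_eps_delta dist_norm real_norm_def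
      by (meson half_gt_zero)
    define e where "e = min r (min d1 d2) / (2 * K)"
    have e: "0 < e" using r d1 d2 K by (simp add: e_def)
    have "e * K = min r (min d1 d2) / 2" using K by (simp add: e_def)
    then have "e * K < r" "e * K < d1" "e * K < d2" using r(1) d1(1) d2(1) by linarith+
    have "\<bar>\<Delta> e / e\<^sup>2 - F u v p\<bar> < \<epsilon> / 2"
      by (rule near[OF _ e \<open>e * K < r\<close> d1(2)]) (use \<open>e * K < d1\<close> in auto)
    moreover have "\<bar>\<Delta> e / e\<^sup>2 - F v u p\<bar> < \<epsilon> / 2"
      by (rule near[OF _ e \<open>e * K < r\<close> d2(2)]) (use \<open>e * K < d2\<close> in auto)
    ultimately show ?thesis by linarith
  qed
  then have "F u v p = F v u p"
    by (metis abs_ge_zero eq_iff_diff_eq_0 less_irrefl zero_less_abs_iff)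
  then show ?thesis by (simp add: F_def)
qed

section \<open>Tensor fields, exterior derivatives and the Nijenhuis tensor\<close>

text \<open>
The product rule for a tensor field evaluated on a vector field. The exterior derivatives and the
Christoffel symbols differentiate tensors on constant vector fields only; this rule passes from these
to arbitrary vector fields, in the Nijenhuis tensor and in the second covariant derivative.
\<close>

lemma has_derivative_tensor_apply:
  fixes T :: "'a::euclidean_space \<Rightarrow> 'c::euclidean_space \<Rightarrow> 'b::real_normed_vector"
  assumes "open S" "p \<in> S" and lin: "\<And>q. q \<in> S \<Longrightarrow> linear (T q)"
    and T: "\<And>V. (\<lambda>q. T q V) differentiable (at p)" and W: "(W has_derivative W') (at p)"
  shows "((\<lambda>q. T q (W q)) has_derivative
    (\<lambda>v. dir_deriv (\<lambda>q. T q (W p)) p v + T p (W' v))) (at p)"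
proof -
  have expand: "T q V = (\<Sum>b\<in>Basis. (V \<bullet> b) *\<^sub>R T q b)" if "q \<in> S" for q V
    using lin[OF that] euclidean_representation[of V]
    by (metis (no_types, lifting) linear_scale linear_sum sum.cong)
  have gen: "((\<lambda>q. T q (W q)) has_derivative
      (\<lambda>v. (\<Sum>b\<in>Basis. (W p \<bullet> b) *\<^sub>R dir_deriv (\<lambda>q. T q b) p v) + T p (W' v))) (at p)"
    if W: "(W has_derivative W') (at p)" for W W'
  proof (rule has_derivative_transform_within_open[OF _ assms(1,2)])
    have "((\<lambda>q. \<Sum>b\<in>Basis. (W q \<bullet> b) *\<^sub>R T q b) has_derivative (\<lambda>v. \<Sum>b\<in>Basis.
        (W p \<bullet> b) *\<^sub>R dir_deriv (\<lambda>q. T q b) p v + (W' v \<bullet> b) *\<^sub>R T p b)) (at p)"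
      by (intro has_derivative_sum has_derivative_scaleR has_derivative_inner_left W
          differentiable_imp_has_derivative T)
    then show "((\<lambda>q. \<Sum>b\<in>Basis. (W q \<bullet> b) *\<^sub>R T q b) has_derivative
        (\<lambda>v. (\<Sum>b\<in>Basis. (W p \<bullet> b) *\<^sub>R dir_deriv (\<lambda>q. T q b) p v) + T p (W' v))) (at p)"
      by (simp add: sum.distrib expand[OF assms(2), of "W' v" for v])
  qed (simp add: expand)
  have "dir_deriv (\<lambda>q. T q (W p)) p = (\<lambda>v. \<Sum>b\<in>Basis. (W p \<bullet> b) *\<^sub>R dir_deriv (\<lambda>q. T q b) p v)"
    using dir_deriv_eqI[OF gen[of "\<lambda>_. W p" "\<lambda>_. 0"]] linear_0[OF lin[OF assms(2)]] by simp
  with gen[OF W] show ?thesis by simp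
qed

lemmas dir_deriv_tensor_apply = dir_deriv_eqI[OF has_derivative_tensor_apply]

subsection \<open>Computing exterior derivatives\<close>

text \<open>
Differentiability is part of the relation, so that the rules for sums and products below compose
without separate differentiability conditions.
\<close>

definition has_ext_deriv ::
  "('a::euclidean_space \<Rightarrow> 'a \<Rightarrow> real) \<Rightarrow> ('a \<Rightarrow> 'a \<Rightarrow> real) \<Rightarrow> 'a \<Rightarrow> bool"
  where "has_ext_deriv \<alpha> \<omega> p \<longleftrightarrow>
    (\<forall>X. (\<lambda>q. \<alpha> q X) differentiable (at p)) \<and> (\<forall>X Y. ext_deriv1 \<alpha> p X Y = \<omega> X Y)"

definition has_ext_deriv2 ::
  "('a::euclidean_space \<Rightarrow> 'a \<Rightarrow> 'a \<Rightarrow> real) \<Rightarrow> ('a \<Rightarrow> 'a \<Rightarrow> 'a \<Rightarrow> real) \<Rightarrow> 'a \<Rightarrow> bool"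
  where "has_ext_deriv2 \<Omega> \<Psi> p \<longleftrightarrow>
    (\<forall>X Y. (\<lambda>q. \<Omega> q X Y) differentiable (at p)) \<and>
    (\<forall>X Y Z. ext_deriv2 \<Omega> p X Y Z = \<Psi> X Y Z)"

lemma has_ext_derivD:
  "has_ext_deriv \<alpha> \<omega> p \<Longrightarrow> ext_deriv1 \<alpha> p X Y = \<omega> X Y"
  "has_ext_deriv \<alpha> \<omega> p \<Longrightarrow> ((\<lambda>q. \<alpha> q X) has_derivative dir_deriv (\<lambda>q. \<alpha> q X) p) (at p)"
  by (auto simp: has_ext_deriv_def differentiable_imp_has_derivative)

lemma has_ext_deriv2D:
  "has_ext_deriv2 \<Omega> \<Psi> p \<Longrightarrow> ext_deriv2 \<Omega> p X Y Z = \<Psi> X Y Z"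
  "has_ext_deriv2 \<Omega> \<Psi> p \<Longrightarrow>
    ((\<lambda>q. \<Omega> q X Y) has_derivative dir_deriv (\<lambda>q. \<Omega> q X Y) p) (at p)"
  by (auto simp: has_ext_deriv2_def differentiable_imp_has_derivative)

lemma has_ext_deriv_eq_rhs:
  "has_ext_deriv \<alpha> \<omega> p \<Longrightarrow> (\<And>X Y. \<omega> X Y = \<omega>' X Y) \<Longrightarrow> has_ext_deriv \<alpha> \<omega>' p"
  by (simp add: has_ext_deriv_def)

lemma has_ext_deriv_const: "has_ext_deriv (\<lambda>_. \<beta>) (\<lambda>_ _. 0) p"
  by (simp add: has_ext_deriv_def ext_deriv1_def)

lemma has_ext_derivI:
  assumes "\<And>X. ((\<lambda>q. \<alpha> q X) has_derivative D X) (at p)" "\<And>X Y. D Y X - D X Y = \<omega> X Y"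
  shows "has_ext_deriv \<alpha> \<omega> p"
  using assms(2) differentiableI[OF assms(1)]
  by (auto simp: has_ext_deriv_def ext_deriv1_def dir_deriv_eqI[OF assms(1)])

lemma has_ext_deriv_add:
  assumes "has_ext_deriv \<alpha> \<omega> p" "has_ext_deriv \<beta> \<eta> p"
  shows "has_ext_deriv (\<lambda>q X. \<alpha> q X + \<beta> q X) (\<lambda>X Y. \<omega> X Y + \<eta> X Y) p"
  by (rule has_ext_derivI[OF has_derivative_add,
        OF has_ext_derivD(2)[OF assms(1)] has_ext_derivD(2)[OF assms(2)]])
     (simp add: has_ext_derivD(1)[OF assms(1), symmetric]
       has_ext_derivD(1)[OF assms(2), symmetric] ext_deriv1_def)

lemma has_ext_deriv_diff:
  assumes "has_ext_deriv \<alpha> \<omega> p" "has_ext_deriv \<beta> \<eta> p"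
  shows "has_ext_deriv (\<lambda>q X. \<alpha> q X - \<beta> q X) (\<lambda>X Y. \<omega> X Y - \<eta> X Y) p"
  by (rule has_ext_derivI[OF has_derivative_diff,
        OF has_ext_derivD(2)[OF assms(1)] has_ext_derivD(2)[OF assms(2)]])
     (simp add: has_ext_derivD(1)[OF assms(1), symmetric]
       has_ext_derivD(1)[OF assms(2), symmetric] ext_deriv1_def)

lemma has_ext_deriv_scale:
  assumes "(f has_derivative f') (at p)" "has_ext_deriv \<alpha> \<omega> p"
  shows "has_ext_deriv (\<lambda>q X. f q * \<alpha> q X) (\<lambda>X Y. wedge11 f' (\<alpha> p) X Y + f p * \<omega> X Y) p"
  by (rule has_ext_derivI[OF has_derivative_mult, OF assms(1) has_ext_derivD(2)[OF assms(2)]])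
     (simp add: has_ext_derivD(1)[OF assms(2), symmetric] ext_deriv1_def wedge11_def algebra_simps)

lemma ext_deriv2_cong:
  assumes "open S" "p \<in> S" "\<And>q X Y. q \<in> S \<Longrightarrow> \<Omega> q X Y = \<Omega>' q X Y"
  shows "ext_deriv2 \<Omega> p X Y Z = ext_deriv2 \<Omega>' p X Y Z"
proof -
  have "dir_deriv (\<lambda>q. \<Omega> q A B) p = dir_deriv (\<lambda>q. \<Omega>' q A B) p" for A B
    by (rule dir_deriv_cong[OF assms(1,2)]) (rule assms(3))
  then show ?thesis by (simp add: ext_deriv2_def)
qed

lemma ext_deriv1_cong:
  assumes "open S" "p \<in> S" "\<And>q X. q \<in> S \<Longrightarrow> \<alpha> q X = \<beta> q X"
  shows "ext_deriv1 \<alpha> p X Y = ext_deriv1 \<beta> p X Y"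
proof -
  have "dir_deriv (\<lambda>q. \<alpha> q A) p = dir_deriv (\<lambda>q. \<beta> q A) p" for A
    by (rule dir_deriv_cong[OF assms(1,2)]) (rule assms(3))
  then show ?thesis by (simp add: ext_deriv1_def)
qed

lemma has_ext_deriv2_eq_rhs:
  "has_ext_deriv2 \<Omega> \<Psi> p \<Longrightarrow> (\<And>X Y Z. \<Psi> X Y Z = \<Psi>' X Y Z) \<Longrightarrow> has_ext_deriv2 \<Omega> \<Psi>' p"
  by (simp add: has_ext_deriv2_def)

lemma has_ext_deriv2I:
  assumes "\<And>X Y. ((\<lambda>q. \<Omega> q X Y) has_derivative D X Y) (at p)"
    and "\<And>X Y Z. D Y Z X + D Z X Y + D X Y Z = \<Psi> X Y Z"
  shows "has_ext_deriv2 \<Omega> \<Psi> p"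
  using assms(2) differentiableI[OF assms(1)]
  by (auto simp: has_ext_deriv2_def ext_deriv2_def dir_deriv_eqI[OF assms(1)])

lemma has_ext_deriv2_wedge:
  assumes "has_ext_deriv \<alpha> \<omega> p" "has_ext_deriv \<beta> \<eta> p"
  shows "has_ext_deriv2 (\<lambda>q X Y. wedge11 (\<alpha> q) (\<beta> q) X Y)
    (\<lambda>X Y Z. wedge12 (\<beta> p) \<omega> X Y Z - wedge12 (\<alpha> p) \<eta> X Y Z) p"
  unfolding wedge11_def
  by (rule has_ext_deriv2I[OF has_derivative_diff[OF has_derivative_mult has_derivative_mult],
        OF has_ext_derivD(2)[OF assms(1)] has_ext_derivD(2)[OF assms(2)]
          has_ext_derivD(2)[OF assms(1)] has_ext_derivD(2)[OF assms(2)]])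
     (simp add: has_ext_derivD(1)[OF assms(1), symmetric] wedge12_def
       has_ext_derivD(1)[OF assms(2), symmetric] ext_deriv1_def algebra_simps)

lemma has_ext_deriv2_add:
  assumes "has_ext_deriv2 \<Omega> \<Psi> p" "has_ext_deriv2 \<Omega>' \<Psi>' p"
  shows "has_ext_deriv2 (\<lambda>q X Y. \<Omega> q X Y + \<Omega>' q X Y) (\<lambda>X Y Z. \<Psi> X Y Z + \<Psi>' X Y Z) p"
  by (rule has_ext_deriv2I[OF has_derivative_add,
        OF has_ext_deriv2D(2)[OF assms(1)] has_ext_deriv2D(2)[OF assms(2)]])
     (simp add: has_ext_deriv2D(1)[OF assms(1), symmetric]
       has_ext_deriv2D(1)[OF assms(2), symmetric] ext_deriv2_def)

lemma has_ext_deriv2_cmult: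
  assumes "has_ext_deriv2 \<Omega> \<Psi> p"
  shows "has_ext_deriv2 (\<lambda>q X Y. c * \<Omega> q X Y) (\<lambda>X Y Z. c * \<Psi> X Y Z) p"
  by (rule has_ext_deriv2I[OF has_derivative_mult_right, OF has_ext_deriv2D(2)[OF assms]])
     (simp add: has_ext_deriv2D(1)[OF assms(1), symmetric] ext_deriv2_def algebra_simps)

subsection \<open>The Nijenhuis tensor\<close>

text \<open>
The derivatives of \<open>X\<close> and \<open>Y\<close> cancel because \<open>J\<^sup>2 = -1\<close>: the Nijenhuis tensor is tensorial.
\<close>

lemma nijenhuis_eq:
  fixes J :: "'a::euclidean_space \<Rightarrow> 'a \<Rightarrow> 'a"
  assumes M: "open M" "p \<in> M" and lin: "\<And>q. q \<in> M \<Longrightarrow> linear (J q)"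
    and J2: "\<And>V. J p (J p V) = - V"
    and dJ: "\<And>V. (\<lambda>q. J q V) differentiable (at p)"
    and X: "X differentiable (at p)" and Y: "Y differentiable (at p)"
  defines "DJ v V \<equiv> dir_deriv (\<lambda>q. J q V) p v"
  shows "nijenhuis J X Y p =
    DJ (J p (X p)) (Y p) - DJ (J p (Y p)) (X p) + J p (DJ (Y p) (X p)) - J p (DJ (X p) (Y p))"
proof -
  have D: "dir_deriv (\<lambda>q. J q (W q)) p v = DJ v (W p) + J p (dir_deriv W p v)"
    if "W differentiable (at p)" for W v
    unfolding DJ_def
    by (rule dir_deriv_tensor_apply[OF M lin dJ differentiable_imp_has_derivative[OF that],
          THEN fun_cong])
  show ?thesis
    unfolding nijenhuis_def lie_bracket_def D[OF X] D[OF Y]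
    by (simp add: linear_add[OF lin[OF M(2)]] linear_diff[OF lin[OF M(2)]] J2)
qed

text \<open>
The hypotheses say that \<open>u + i v\<close> is a form of type \<open>(1, 0)\<close>. Differentiating them expresses the
derivative of \<open>J\<close> through those of \<open>u\<close> and \<open>v\<close>; the right-hand side is the real part of the
\<open>(0, 2)\<close> component of \<open>d(u + i v)\<close>, up to a constant factor.
\<close>

lemma form_nijenhuis:
  fixes J :: "'a::euclidean_space \<Rightarrow> 'a \<Rightarrow> 'a"
  assumes M: "open M" "p \<in> M" and lin: "\<And>q. q \<in> M \<Longrightarrow> linear (J q)"
    and J2: "\<And>V. J p (J p V) = - V"
    and dJ: "\<And>V. (\<lambda>q. J q V) differentiable (at p)"
    and X: "X differentiable (at p)" and Y: "Y differentiable (at p)"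
    and u: "has_ext_deriv u \<mu> p" "\<And>q. q \<in> M \<Longrightarrow> linear (u q)"
      "\<And>q V. q \<in> M \<Longrightarrow> u q (J q V) = - v q V"
    and v: "has_ext_deriv v \<nu> p" "\<And>q. q \<in> M \<Longrightarrow> linear (v q)"
      "\<And>q V. q \<in> M \<Longrightarrow> v q (J q V) = u q V"
  shows "u p (nijenhuis J X Y p) = \<mu> (X p) (Y p) - \<mu> (J p (X p)) (J p (Y p))
    - \<nu> (J p (X p)) (Y p) - \<nu> (X p) (J p (Y p))"
proof -
  define DJ where "DJ v V = dir_deriv (\<lambda>q. J q V) p v" for v V
  have diff: "(\<lambda>q. u q V) differentiable (at p)" "(\<lambda>q. v q V) differentiable (at p)" for V
    using u(1) v(1) by (auto simp: has_ext_deriv_def)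
  have Ju: "dir_deriv (\<lambda>q. u q (J p V)) p w + u p (DJ w V) = - dir_deriv (\<lambda>q. v q V) p w" for V w
  proof -
    have "dir_deriv (\<lambda>q. u q (J q V)) p w = dir_deriv (\<lambda>q. - v q V) p w"
      by (rule dir_deriv_cong[OF M, THEN fun_cong]) (rule u(3))
    moreover have "dir_deriv (\<lambda>q. - v q V) p w = - dir_deriv (\<lambda>q. v q V) p w"
      using dir_deriv_eqI[OF has_derivative_minus[OF differentiable_imp_has_derivative[OF diff(2)]]]
      by metis
    ultimately show ?thesis
      using dir_deriv_tensor_apply[OF M u(2) diff(1) differentiable_imp_has_derivative[OF dJ], of V]
      by (simp add: DJ_def)
  qed
  have Jv: "dir_deriv (\<lambda>q. v q (J p V)) p w + v p (DJ w V) = dir_deriv (\<lambda>q. u q V) p w" for V w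
  proof -
    have "dir_deriv (\<lambda>q. v q (J q V)) p w = dir_deriv (\<lambda>q. u q V) p w"
      by (rule dir_deriv_cong[OF M, THEN fun_cong]) (rule v(3))
    then show ?thesis
      using dir_deriv_tensor_apply[OF M v(2) diff(2) differentiable_imp_has_derivative[OF dJ], of V]
      by (simp add: DJ_def)
  qed
  have "nijenhuis J X Y p = DJ (J p (X p)) (Y p) - DJ (J p (Y p)) (X p)
      + J p (DJ (Y p) (X p)) - J p (DJ (X p) (Y p))"
    unfolding DJ_def by (rule nijenhuis_eq[OF M lin J2 dJ X Y])
  then have "u p (nijenhuis J X Y p) = u p (DJ (J p (X p)) (Y p)) - u p (DJ (J p (Y p)) (X p))
      - v p (DJ (Y p) (X p)) + v p (DJ (X p) (Y p))"
    by (simp add: linear_add[OF u(2)[OF M(2)]] linear_diff[OF u(2)[OF M(2)]] u(3)[OF M(2)])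
  then show ?thesis
    using Ju[of "Y p" "J p (X p)"] Ju[of "X p" "J p (Y p)"]
      Jv[of "X p" "Y p"] Jv[of "Y p" "X p"]
    unfolding has_ext_derivD(1)[OF u(1), symmetric] has_ext_derivD(1)[OF v(1), symmetric]
      ext_deriv1_def by linarith
qed

section \<open>Orthonormal frames and Cartan's structure equations\<close>

text \<open>
The last two assumptions, skew symmetry and the first structure equation, characterise the
connection forms \<open>w\<close> of the Levi-Civita connection in the orthonormal coframe \<open>e\<close> with dual frame
\<open>E\<close>.
\<close>

locale orthonormal_frame =
  fixes M :: "'a::euclidean_space set"
    and g :: "'a \<Rightarrow> 'a \<Rightarrow> 'a \<Rightarrow> real"
    and e :: "'i::finite \<Rightarrow> 'a \<Rightarrow> 'a \<Rightarrow> real"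
    and E :: "'i \<Rightarrow> 'a \<Rightarrow> 'a"
    and w :: "'i \<Rightarrow> 'i \<Rightarrow> 'a \<Rightarrow> 'a \<Rightarrow> real"
  assumes open_M: "open M"
    and linear_e: "p \<in> M \<Longrightarrow> linear (e i p)"
    and smooth_e: "smooth_on M (\<lambda>p. e i p X)"
    and smooth_E: "smooth_on M (E i)"
    and dual: "p \<in> M \<Longrightarrow> e i p (E j p) = (if i = j then 1 else 0)"
    and expand: "p \<in> M \<Longrightarrow> (\<Sum>i\<in>UNIV. e i p X *\<^sub>R E i p) = X"
    and metric: "p \<in> M \<Longrightarrow> g p X Y = (\<Sum>i\<in>UNIV. e i p X * e i p Y)"
    and linear_w: "p \<in> M \<Longrightarrow> linear (w i j p)"
    and diff_w: "p \<in> M \<Longrightarrow> (\<lambda>q. w i j q X) differentiable (at p)"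
    and skew: "p \<in> M \<Longrightarrow> w i j p X = - w j i p X"
    and torsion_free: "p \<in> M \<Longrightarrow>
      ext_deriv1 (e i) p X Y = - (\<Sum>j\<in>UNIV. wedge11 (w i j p) (e j p) X Y)"
begin

lemma frame_eqI:
  assumes "p \<in> M" "\<And>k. e k p V = e k p W"
  shows "V = W"
proof -
  have "V = (\<Sum>i\<in>UNIV. e i p V *\<^sub>R E i p)" by (rule expand[OF assms(1), symmetric])
  also have "\<dots> = (\<Sum>i\<in>UNIV. e i p W *\<^sub>R E i p)" by (simp only: assms(2))
  also have "\<dots> = W" by (rule expand[OF assms(1)])
  finally show ?thesis .
qed

lemma e_frame_sum: "p \<in> M \<Longrightarrow> e k p (\<Sum>i\<in>UNIV. c i *\<^sub>R E i p) = c k"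
  by (simp only: linear_sum[OF linear_e] linear_scale[OF linear_e] dual real_scaleR_def
      mult_delta_right mult_1_right sum.delta' UNIV_I finite if_True)

lemma diff_e: "p \<in> M \<Longrightarrow> (\<lambda>q. e i q X) differentiable (at p)"
  by (rule smooth_on_differentiable[OF smooth_e open_M])

lemmas deriv_e = differentiable_imp_has_derivative[OF diff_e]
lemmas deriv_w = differentiable_imp_has_derivative[OF diff_w]

lemma dir_deriv_metric:
  assumes "p \<in> M"
  shows "dir_deriv (\<lambda>q. g q Y Z) p X =
    (\<Sum>i\<in>UNIV. dir_deriv (\<lambda>q. e i q Y) p X * e i p Z + e i p Y * dir_deriv (\<lambda>q. e i q Z) p X)"
proof -
  have "dir_deriv (\<lambda>q. g q Y Z) p = dir_deriv (\<lambda>q. \<Sum>i\<in>UNIV. e i q Y * e i q Z) p"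
    by (rule dir_deriv_cong[OF open_M assms]) (rule metric)
  also have "\<dots> = (\<lambda>X. \<Sum>i\<in>UNIV. e i p Y * dir_deriv (\<lambda>q. e i q Z) p X
      + dir_deriv (\<lambda>q. e i q Y) p X * e i p Z)"
    by (intro dir_deriv_eqI has_derivative_sum has_derivative_mult deriv_e assms)
  finally show ?thesis by (simp add: add.commute)
qed

text \<open>
The right-hand side is the covariant derivative of the constant field \<open>Y\<close> computed with the
connection forms. It satisfies the Koszul formula because, written as \<open>W\<close> below, the connection
term is skew in its last two arguments and the structure equation expresses every exterior derivative
of the coframe by two values of \<open>W\<close>.
\<close>

lemma christoffel_frame:
  assumes p: "p \<in> M"
  shows "e k p (christoffel g p X Y) =
    dir_deriv (\<lambda>q. e k q Y) p X + (\<Sum>j\<in>UNIV. w k j p X * e j p Y)"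
proof -
  define D where "D i A B = dir_deriv (\<lambda>q. e i q B) p A" for i A B
  define W where "W A B C = (\<Sum>i\<in>UNIV. \<Sum>j\<in>UNIV. w i j p A * e j p B * e i p C)" for A B C
  have W_skew: "W A B C = - W A C B" for A B C
  proof -
    have "W A B C = (\<Sum>j\<in>UNIV. \<Sum>i\<in>UNIV. w i j p A * e j p B * e i p C)"
      unfolding W_def by (rule sum.swap)
    also have "\<dots> = (\<Sum>j\<in>UNIV. \<Sum>i\<in>UNIV. - (w j i p A * e i p C * e j p B))"
      by (intro sum.cong refl) (subst skew[OF p], simp)
    finally show ?thesis by (simp add: W_def sum_negf)
  qed
  have torsion: "(\<Sum>i\<in>UNIV. e i p C * (D i A B - D i B A)) = W B A C - W A B C" for A B C
  proof -
    have "(\<Sum>i\<in>UNIV. e i p C * (D i A B - D i B A)) =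
        (\<Sum>i\<in>UNIV. e i p C * - (\<Sum>j\<in>UNIV. wedge11 (w i j p) (e j p) A B))"
      by (simp only: torsion_free[OF p, symmetric] ext_deriv1_def D_def)
    also have "\<dots> = W B A C - W A B C"
    proof -
      have "e i p C * - (\<Sum>j\<in>UNIV. wedge11 (w i j p) (e j p) A B) =
          (\<Sum>j\<in>UNIV. w i j p B * e j p A * e i p C) - (\<Sum>j\<in>UNIV. w i j p A * e j p B * e i p C)"
        for i
        by (simp add: wedge11_def sum_subtractf sum_distrib_left right_diff_distrib mult_ac)
      then show ?thesis by (simp add: W_def sum_subtractf)
    qed
    finally show ?thesis .
  qed
  define V where
    "V = (\<Sum>k\<in>UNIV. (D k X Y + (\<Sum>j\<in>UNIV. w k j p X * e j p Y)) *\<^sub>R E k p)"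
  have V: "e k p V = D k X Y + (\<Sum>j\<in>UNIV. w k j p X * e j p Y)" for k
    unfolding V_def by (rule e_frame_sum[OF p])
  have koszul: "2 * g p V Z = dir_deriv (\<lambda>q. g q Y Z) p X + dir_deriv (\<lambda>q. g q X Z) p Y
      - dir_deriv (\<lambda>q. g q X Y) p Z" for Z
  proof -
    have "2 * g p V Z = 2 * (\<Sum>i\<in>UNIV. D i X Y * e i p Z) + 2 * W X Y Z"
      by (simp add: metric[OF p] V W_def distrib_right sum.distrib sum_distrib_right)
    moreover have "dir_deriv (\<lambda>q. g q Y Z) p X + dir_deriv (\<lambda>q. g q X Z) p Y
        - dir_deriv (\<lambda>q. g q X Y) p Z =
      2 * (\<Sum>i\<in>UNIV. D i X Y * e i p Z) - (\<Sum>i\<in>UNIV. e i p Z * (D i X Y - D i Y X))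
        + (\<Sum>i\<in>UNIV. e i p Y * (D i X Z - D i Z X))
        + (\<Sum>i\<in>UNIV. e i p X * (D i Y Z - D i Z Y))"
      by (simp add: dir_deriv_metric[OF p] D_def sum.distrib sum_subtractf algebra_simps)
    ultimately show ?thesis
      unfolding torsion using W_skew[of X Y Z] W_skew[of Y X Z] W_skew[of Z X Y] by simp
  qed
  have "christoffel g p X Y = V"
    unfolding christoffel_def
  proof (rule the_equality)
    fix V' assume "\<forall>Z. 2 * g p V' Z = dir_deriv (\<lambda>q. g q Y Z) p X
      + dir_deriv (\<lambda>q. g q X Z) p Y - dir_deriv (\<lambda>q. g q X Y) p Z"
    then have "g p V' (E k p) = g p V (E k p)" for k
      using koszul by (metis mult_cancel_left zero_neq_numeral)
    then have "e k p V' = e k p V" for k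
      by (simp add: metric[OF p] dual[OF p] mult_delta_right)
    then show "V' = V" by (rule frame_eqI[OF p])
  qed (use koszul in blast)
  then show ?thesis using V by (simp add: D_def)
qed

lemma levi_civita_frame:
  assumes p: "p \<in> M" and Y: "Y differentiable (at p)"
  shows "e k p (levi_civita g X Y p) =
    dir_deriv (\<lambda>q. e k q (Y q)) p (X p) + (\<Sum>j\<in>UNIV. w k j p (X p) * e j p (Y p))"
proof -
  have "dir_deriv (\<lambda>q. e k q (Y q)) p =
      (\<lambda>v. dir_deriv (\<lambda>q. e k q (Y p)) p v + e k p (dir_deriv Y p v))"
    by (rule dir_deriv_tensor_apply[where T = "e k" and W = Y, OF open_M p linear_e diff_e[OF p]
          differentiable_imp_has_derivative[OF Y]])
  then show ?thesis
    unfolding levi_civita_def linear_add[OF linear_e[OF p]] christoffel_frame[OF p] by simp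
qed

lemma levi_civita_const_differentiable:
  assumes p: "p \<in> M"
  shows "levi_civita g (\<lambda>_. Y) (\<lambda>_. Z) differentiable (at p)"
proof -
  let ?c = "\<lambda>q k. dir_deriv (\<lambda>q. e k q Z) q Y + (\<Sum>j\<in>UNIV. w k j q Y * e j q Z)"
  have "(\<lambda>q. ?c q k) differentiable (at p)" for k
  proof (rule differentiable_add)
    show "(\<lambda>q. dir_deriv (\<lambda>q. e k q Z) q Y) differentiable (at p)"
      by (rule smooth_on_differentiable[OF smooth_on_dir_deriv[OF smooth_e] open_M p])
    show "(\<lambda>q. \<Sum>j\<in>UNIV. w k j q Y * e j q Z) differentiable (at p)"
    proof (rule differentiable_sum[OF finite], rule ballI)
      show "(\<lambda>q. w k j q Y * e j q Z) differentiable (at p)" for j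
        by (rule differentiable_mult[OF diff_w[OF p] diff_e[OF p]])
    qed
  qed
  then have c: "((\<lambda>q. ?c q k) has_derivative dir_deriv (\<lambda>q. ?c q k) p) (at p)" for k
    by (rule differentiable_imp_has_derivative)
  have "((\<lambda>q. \<Sum>k\<in>UNIV. ?c q k *\<^sub>R E k q) has_derivative
      (\<lambda>v. \<Sum>k\<in>UNIV. ?c p k *\<^sub>R dir_deriv (E k) p v + dir_deriv (\<lambda>q. ?c q k) p v *\<^sub>R E k p)) (at p)"
    by (rule has_derivative_sum, rule has_derivative_scaleR[OF c])
       (rule smooth_on_has_derivative[OF smooth_E open_M p])
  then have "(levi_civita g (\<lambda>_. Y) (\<lambda>_. Z) has_derivative
      (\<lambda>v. \<Sum>k\<in>UNIV. ?c p k *\<^sub>R dir_deriv (E k) p v + dir_deriv (\<lambda>q. ?c q k) p v *\<^sub>R E k p)) (at p)"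
  proof (rule has_derivative_transform_within_open[OF _ open_M p])
    show "(\<Sum>k\<in>UNIV. ?c q k *\<^sub>R E k q) = levi_civita g (\<lambda>_. Y) (\<lambda>_. Z) q" if "q \<in> M" for q
    proof (rule frame_eqI[OF that])
      show "e k q (\<Sum>k\<in>UNIV. ?c q k *\<^sub>R E k q) = e k q (levi_civita g (\<lambda>_. Y) (\<lambda>_. Z) q)" for k
        unfolding levi_civita_frame[OF that differentiable_const] by (rule e_frame_sum[OF that])
    qed
  qed
  then show ?thesis by (rule differentiableI)
qed

text \<open>
The second structure equation. In the antisymmetrised second covariant derivative of a constant
field the second derivatives of \<open>e k\<close> cancel by symmetry, and so do the products of first derivatives
with connection forms.
\<close>

lemma curvature_frame:
  assumes p: "p \<in> M"
  shows "e k p (curvature g (\<lambda>_. X) (\<lambda>_. Y) (\<lambda>_. Z) p) =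
    (\<Sum>j\<in>UNIV. (ext_deriv1 (w k j) p X Y + (\<Sum>m\<in>UNIV. wedge11 (w k m p) (w m j p) X Y)) * e j p Z)"
proof -
  define N where "N Y = levi_civita g (\<lambda>_. Y) (\<lambda>_. Z)" for Y
  have N: "e k q (N Y q) = dir_deriv (\<lambda>q. e k q Z) q Y + (\<Sum>j\<in>UNIV. w k j q Y * e j q Z)"
    if "q \<in> M" for k q Y
    unfolding N_def by (rule levi_civita_frame[OF that differentiable_const])
  have dN: "dir_deriv (\<lambda>q. e k q (N Y q)) p X = dir_deriv (\<lambda>q. dir_deriv (\<lambda>q. e k q Z) q Y) p X
      + (\<Sum>j\<in>UNIV. w k j p Y * dir_deriv (\<lambda>q. e j q Z) p X
          + dir_deriv (\<lambda>q. w k j q Y) p X * e j p Z)" for X Y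
  proof -
    have "dir_deriv (\<lambda>q. e k q (N Y q)) p = dir_deriv (\<lambda>q. dir_deriv (\<lambda>q. e k q Z) q Y
        + (\<Sum>j\<in>UNIV. w k j q Y * e j q Z)) p"
      by (rule dir_deriv_cong[OF open_M p]) (rule N)
    also have "\<dots> = (\<lambda>X. dir_deriv (\<lambda>q. dir_deriv (\<lambda>q. e k q Z) q Y) p X
      + (\<Sum>j\<in>UNIV. w k j p Y * dir_deriv (\<lambda>q. e j q Z) p X
          + dir_deriv (\<lambda>q. w k j q Y) p X * e j p Z))"
      by (intro dir_deriv_eqI has_derivative_add has_derivative_sum has_derivative_mult
          deriv_e deriv_w p smooth_on_has_derivative[OF smooth_on_dir_deriv[OF smooth_e] open_M])
    finally show ?thesis by simp
  qed
  have NN: "e k p (levi_civita g (\<lambda>_. X) (N Y) p) =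
      dir_deriv (\<lambda>q. dir_deriv (\<lambda>q. e k q Z) q Y) p X
      + (\<Sum>j\<in>UNIV. w k j p Y * dir_deriv (\<lambda>q. e j q Z) p X
          + w k j p X * dir_deriv (\<lambda>q. e j q Z) p Y)
      + (\<Sum>j\<in>UNIV. dir_deriv (\<lambda>q. w k j q Y) p X * e j p Z)
      + (\<Sum>j\<in>UNIV. (\<Sum>m\<in>UNIV. w k m p X * w m j p Y) * e j p Z)" for X Y
  proof -
    have "(\<Sum>m\<in>UNIV. \<Sum>j\<in>UNIV. w k m p X * (w m j p Y * e j p Z)) =
        (\<Sum>j\<in>UNIV. (\<Sum>m\<in>UNIV. w k m p X * w m j p Y) * e j p Z)"
      by (subst sum.swap) (simp add: sum_distrib_right mult.assoc)
    then show ?thesis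
      using levi_civita_const_differentiable[OF p, of Y Z]
      by (simp add: levi_civita_frame[OF p] N_def[symmetric] dN N[OF p] sum.distrib
          distrib_left sum_distrib_left)
  qed
  have bracket: "lie_bracket (\<lambda>_. X) (\<lambda>_. Y) = (\<lambda>_. 0)"
    by (simp add: lie_bracket_def fun_eq_iff)
  have "e k p (levi_civita g (\<lambda>_. 0) (\<lambda>_. Z) p) = 0"
    by (simp add: levi_civita_frame[OF p] linear_0[OF linear_w[OF p]]
        linear_0[OF linear_frechet_derivative[OF diff_e[OF p]]])
  then have "e k p (curvature g (\<lambda>_. X) (\<lambda>_. Y) (\<lambda>_. Z) p) =
      e k p (levi_civita g (\<lambda>_. X) (N Y) p) - e k p (levi_civita g (\<lambda>_. Y) (N X) p)"
    by (simp add: curvature_def bracket linear_diff[OF linear_e[OF p]] N_def)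
  then show ?thesis
    unfolding NN dir_deriv_commute[OF open_M p smooth_e[of k Z], of Y X]
    by (simp add: ext_deriv1_def wedge11_def sum.distrib sum_subtractf algebra_simps)
qed

text \<open>
The trace of \<open>ricci\<close> in the standard basis is rewritten as the trace in the frame, which needs the
curvature to be linear in its first argument.
\<close>

lemma ricci_frame:
  assumes p: "p \<in> M"
    and R: "\<And>k j X Y. ext_deriv1 (w k j) p X Y
      + (\<Sum>m\<in>UNIV. wedge11 (w k m p) (w m j p) X Y) = R k j X Y"
    and linear_R: "\<And>k j Y. linear (\<lambda>X. R k j X Y)"
  shows "ricci g p Y Z = (\<Sum>j\<in>UNIV. \<Sum>k\<in>UNIV. R k j (E k p) Y * e j p Z)"
proof -
  have trace: "R k j (E k p) Y = (\<Sum>b\<in>Basis. (E k p \<bullet> b) * R k j b Y)" for k j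
  proof -
    have "R k j (E k p) Y = R k j (\<Sum>b\<in>Basis. (E k p \<bullet> b) *\<^sub>R b) Y"
      by (simp only: euclidean_representation)
    also have "\<dots> = (\<Sum>b\<in>Basis. (E k p \<bullet> b) * R k j b Y)"
      by (simp only: linear_sum[OF linear_R] linear_scale[OF linear_R] real_scaleR_def)
    finally show ?thesis .
  qed
  have "ricci g p Y Z =
      (\<Sum>b\<in>Basis. \<Sum>k\<in>UNIV. \<Sum>j\<in>UNIV. R k j b Y * e j p Z * (E k p \<bullet> b))"
    unfolding ricci_def
  proof (rule sum.cong[OF refl])
    fix b :: 'a
    let ?V = "curvature g (\<lambda>_. b) (\<lambda>_. Y) (\<lambda>_. Z) p"
    have "?V \<bullet> b = (\<Sum>k\<in>UNIV. e k p ?V *\<^sub>R E k p) \<bullet> b"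
      by (simp only: expand[OF p])
    then show "?V \<bullet> b = (\<Sum>k\<in>UNIV. \<Sum>j\<in>UNIV. R k j b Y * e j p Z * (E k p \<bullet> b))"
      by (simp only: curvature_frame[OF p] R inner_sum_left inner_scaleR_left sum_distrib_right)
  qed
  also have "\<dots> = (\<Sum>k\<in>UNIV. \<Sum>j\<in>UNIV. \<Sum>b\<in>Basis. R k j b Y * e j p Z * (E k p \<bullet> b))"
    by (subst sum.swap) (intro sum.cong refl, subst sum.swap, rule refl)
  also have "\<dots> = (\<Sum>k\<in>UNIV. \<Sum>j\<in>UNIV. R k j (E k p) Y * e j p Z)"
    by (simp add: trace sum_distrib_right sum_distrib_left mult_ac)
  also have "\<dots> = (\<Sum>j\<in>UNIV. \<Sum>k\<in>UNIV. R k j (E k p) Y * e j p Z)"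
    by (rule sum.swap)
  finally show ?thesis .
qed

end

section \<open>The horizontal forms and their exterior derivatives\<close>

abbreviation height :: "plane \<times> plane \<Rightarrow> real" where "height p \<equiv> fst (snd p)"

abbreviation angle :: "plane \<times> plane \<Rightarrow> real" where "angle p \<equiv> snd (snd p)"

text \<open>
With \<open>rotated_y\<close> as imaginary part this is \<open>H exp (- i t) (dx + i dy)\<close>. The two forms are \<open>A\<close> and \<open>B\<close>
of the introduction.
\<close>

definition rotated_x :: "(plane \<Rightarrow> real) \<Rightarrow> plane \<times> plane \<Rightarrow> plane \<times> plane \<Rightarrow> real"
  where "rotated_x H p X = H (fst p) * (cos (angle p) * dx X + sin (angle p) * dy X)"

definition rotated_y :: "(plane \<Rightarrow> real) \<Rightarrow> plane \<times> plane \<Rightarrow> plane \<times> plane \<Rightarrow> real"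
  where "rotated_y H p X = H (fst p) * (- sin (angle p) * dx X + cos (angle p) * dy X)"

text \<open>
Up to sign the Hodge dual of \<open>d (ln f)\<close>; its differential is a multiple of the Laplacian of \<open>ln f\<close>.
It is used for \<open>f = H\<close>, and for \<open>f = h\<close> as the connection form of the conformally flat metric
\<open>g_Sigma h\<close>.
\<close>

definition conj_dlog :: "(plane \<Rightarrow> real) \<Rightarrow> plane \<times> plane \<Rightarrow> plane \<times> plane \<Rightarrow> real"
  where "conj_dlog f p X = l2 f (fst p) * dx X + n2 f (fst p) * dy X"

text \<open>
The form \<open>\<tau>\<close> of the introduction.
\<close>

definition angle_form :: "(plane \<Rightarrow> real) \<Rightarrow> plane \<times> plane \<Rightarrow> plane \<times> plane \<Rightarrow> real"
  where "angle_form f p X = dt X - conj_dlog f p X"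

lemma theta4_eq: "theta4 H p X = dz X - rotated_x H p X"
  by (cases p) (auto simp: theta4_def rotated_x_def algebra_simps)

lemma theta3_eq:
  "theta3 H p X = sinh (height p) * angle_form H p X - cosh (height p) * rotated_y H p X"
  by (cases p) (auto simp: theta3_def rotated_y_def angle_form_def conj_dlog_def algebra_simps)

lemma linear_coordinate_forms: "linear dx" "linear dy" "linear dz" "linear dt"
  by (auto simp: dx_def dy_def dz_def dt_def intro!: linearI)

lemma linear_real_cmult: "linear f \<Longrightarrow> linear (\<lambda>X. c * f X)" for f :: "'a::real_vector \<Rightarrow> real"
  by (auto intro!: linearI simp: linear_add linear_scale algebra_simps)

lemma linear_rotated_y: "linear (rotated_y H p)"
  and linear_conj_dlog: "linear (conj_dlog f p)"
  and linear_angle_form: "linear (angle_form f p)"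
  and linear_theta3: "linear (theta3 H p)"
  and linear_theta4: "linear (theta4 H p)"
  unfolding rotated_x_def rotated_y_def[abs_def] conj_dlog_def[abs_def] angle_form_def[abs_def]
    theta3_eq[abs_def] theta4_eq[abs_def]
  by (intro linear_real_cmult linear_compose_add linear_compose_sub linear_coordinate_forms)+

lemma has_derivative_pullback:
  assumes "f differentiable (at (fst p))"
  shows "((\<lambda>q. f (fst q)) has_derivative
    (\<lambda>v. partial_x f (fst p) * dx v + partial_y f (fst p) * dy v)) (at p)"
proof -
  have D: "(f has_derivative dir_deriv f (fst p)) (at (fst p))"
    using assms by (rule differentiable_imp_has_derivative)
  have "dir_deriv f (fst p) w = partial_x f (fst p) * fst w + partial_y f (fst p) * snd w" for w
  proof -
    have "w = fst w *\<^sub>R (1, 0) + snd w *\<^sub>R (0, 1)" by (simp add: prod_eq_iff)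
    then have "dir_deriv f (fst p) w = dir_deriv f (fst p) (fst w *\<^sub>R (1, 0) + snd w *\<^sub>R (0, 1))"
      by simp
    also have "\<dots> = fst w * partial_x f (fst p) + snd w * partial_y f (fst p)"
      using has_derivative_linear[OF D]
      by (simp only: linear_add linear_scale partial_x_def partial_y_def real_scaleR_def)
    finally show ?thesis by (simp add: mult.commute)
  qed
  then show ?thesis
    using diff_chain_at[OF has_derivative_fst[OF has_derivative_ident] D]
    by (simp add: o_def dx_def dy_def)
qed

text \<open>
These relations replace the derivatives of \<open>f\<close> by \<open>f l2\<close> and \<open>f n2\<close>, after which the equations
for \<open>dA\<close> and \<open>dB\<close> are polynomial identities.
\<close>

lemma partial_ln:
  assumes "f differentiable (at q)" "0 < f q"
  shows "f q * l2 f q = partial_y f q" "f q * n2 f q = - partial_x f q"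
proof -
  have "((\<lambda>q. ln (f q)) has_derivative (\<lambda>v. inverse (f q) * dir_deriv f q v)) (at q)"
    using differentiable_imp_has_derivative[OF assms(1)] assms(2)
    by (auto intro!: derivative_eq_intros simp: field_simps)
  then show "f q * l2 f q = partial_y f q" "f q * n2 f q = - partial_x f q"
    using assms(2) by (simp_all add: l2_def n2_def partial_x_def partial_y_def dir_deriv_eqI)
qed

lemma has_derivative_fiber:
  fixes p :: "plane \<times> plane"
  shows "((\<lambda>q. cos (angle q)) has_derivative (\<lambda>v. - sin (angle p) * dt v)) (at p)"
    and "((\<lambda>q. sin (angle q)) has_derivative (\<lambda>v. cos (angle p) * dt v)) (at p)"
    and "((\<lambda>q. sinh (height q)) has_derivative (\<lambda>v. cosh (height p) * dz v)) (at p)"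
    and "((\<lambda>q. cosh (height q)) has_derivative (\<lambda>v. sinh (height p) * dz v)) (at p)"
    and "((\<lambda>q. sinh (height q / 2)) has_derivative
      (\<lambda>v. 1 / 2 * cosh (height p / 2) * dz v)) (at p)"
    and "((\<lambda>q. cosh (height q / 2)) has_derivative
      (\<lambda>v. 1 / 2 * sinh (height p / 2) * dz v)) (at p)"
proof -
  have t: "((\<lambda>q. angle q) has_derivative dt) (at p)"
    and z: "((\<lambda>q. height q) has_derivative dz) (at p)"
    by (auto intro!: derivative_eq_intros simp: dz_def dt_def fun_eq_iff)
  have z2: "((\<lambda>q. height q / 2) has_derivative (\<lambda>v. dz v / 2)) (at p)"
    using has_derivative_mult_right[OF z, of "1 / 2"] by simp
  have hyp: "(sinh has_real_derivative cosh a) (at a)" "(cosh has_real_derivative sinh a) (at a)"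
    for a :: real
    by (auto intro!: derivative_eq_intros)
  show "((\<lambda>q. cos (angle q)) has_derivative (\<lambda>v. - sin (angle p) * dt v)) (at p)"
    and "((\<lambda>q. sin (angle q)) has_derivative (\<lambda>v. cos (angle p) * dt v)) (at p)"
    using has_derivative_cos[OF t] has_derivative_sin[OF t] by (simp_all add: mult_ac)
  show "((\<lambda>q. sinh (height q)) has_derivative (\<lambda>v. cosh (height p) * dz v)) (at p)"
    and "((\<lambda>q. cosh (height q)) has_derivative (\<lambda>v. sinh (height p) * dz v)) (at p)"
    and "((\<lambda>q. sinh (height q / 2)) has_derivative
      (\<lambda>v. 1 / 2 * cosh (height p / 2) * dz v)) (at p)"
    and "((\<lambda>q. cosh (height q / 2)) has_derivative
      (\<lambda>v. 1 / 2 * sinh (height p / 2) * dz v)) (at p)"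
    using DERIV_compose_FDERIV[OF hyp(1) z] DERIV_compose_FDERIV[OF hyp(2) z]
      DERIV_compose_FDERIV[OF hyp(1) z2] DERIV_compose_FDERIV[OF hyp(2) z2]
    by (simp_all add: mult_ac)
qed

lemma has_ext_deriv_rotated_x:
  assumes "H differentiable (at (fst p))" "0 < H (fst p)"
  shows "has_ext_deriv (rotated_x H) (wedge11 (angle_form H p) (rotated_y H p)) p"
proof (rule has_ext_deriv_eq_rhs)
  show "has_ext_deriv (rotated_x H) (\<lambda>X Y. wedge11
        (\<lambda>v. partial_x H (fst p) * dx v + partial_y H (fst p) * dy v)
        (\<lambda>X. cos (angle p) * dx X + sin (angle p) * dy X) X Y
      + H (fst p) * ((wedge11 (\<lambda>v. - sin (angle p) * dt v) dx X Y + cos (angle p) * 0)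
        + (wedge11 (\<lambda>v. cos (angle p) * dt v) dy X Y + sin (angle p) * 0))) p"
    unfolding rotated_x_def[abs_def]
    by (rule has_ext_deriv_scale[OF has_derivative_pullback[OF assms(1)] has_ext_deriv_add[OF
          has_ext_deriv_scale[OF has_derivative_fiber(1) has_ext_deriv_const]
          has_ext_deriv_scale[OF has_derivative_fiber(2) has_ext_deriv_const]]])
next
  have "partial_y H (fst p) = H (fst p) * l2 H (fst p)" "partial_x H (fst p) = - H (fst p) * n2 H (fst p)"
    using partial_ln[OF assms] by simp_all
  then show "wedge11
        (\<lambda>v. partial_x H (fst p) * dx v + partial_y H (fst p) * dy v)
        (\<lambda>X. cos (angle p) * dx X + sin (angle p) * dy X) X Y
      + H (fst p) * ((wedge11 (\<lambda>v. - sin (angle p) * dt v) dx X Y + cos (angle p) * 0)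
        + (wedge11 (\<lambda>v. cos (angle p) * dt v) dy X Y + sin (angle p) * 0)) =
      wedge11 (angle_form H p) (rotated_y H p) X Y" for X Y
    by (simp add: wedge11_def angle_form_def conj_dlog_def rotated_y_def algebra_simps)
qed

lemma has_ext_deriv_rotated_y:
  assumes "H differentiable (at (fst p))" "0 < H (fst p)"
  shows "has_ext_deriv (rotated_y H) (\<lambda>X Y. - wedge11 (angle_form H p) (rotated_x H p) X Y) p"
proof (rule has_ext_deriv_eq_rhs)
  show "has_ext_deriv (rotated_y H) (\<lambda>X Y. wedge11
        (\<lambda>v. partial_x H (fst p) * dx v + partial_y H (fst p) * dy v)
        (\<lambda>X. - sin (angle p) * dx X + cos (angle p) * dy X) X Y
      + H (fst p) * ((wedge11 (\<lambda>v. - (cos (angle p) * dt v)) dx X Y + - sin (angle p) * 0)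
        + (wedge11 (\<lambda>v. - sin (angle p) * dt v) dy X Y + cos (angle p) * 0))) p"
    unfolding rotated_y_def[abs_def]
    by (rule has_ext_deriv_scale[OF has_derivative_pullback[OF assms(1)] has_ext_deriv_add[OF
          has_ext_deriv_scale[OF has_derivative_minus[OF has_derivative_fiber(2)] has_ext_deriv_const]
          has_ext_deriv_scale[OF has_derivative_fiber(1) has_ext_deriv_const]]])
next
  have "partial_y H (fst p) = H (fst p) * l2 H (fst p)" "partial_x H (fst p) = - H (fst p) * n2 H (fst p)"
    using partial_ln[OF assms] by simp_all
  then show "wedge11
        (\<lambda>v. partial_x H (fst p) * dx v + partial_y H (fst p) * dy v)
        (\<lambda>X. - sin (angle p) * dx X + cos (angle p) * dy X) X Y
      + H (fst p) * ((wedge11 (\<lambda>v. - (cos (angle p) * dt v)) dx X Y + - sin (angle p) * 0)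
        + (wedge11 (\<lambda>v. - sin (angle p) * dt v) dy X Y + cos (angle p) * 0)) =
      - wedge11 (angle_form H p) (rotated_x H p) X Y" for X Y
    by (simp add: wedge11_def angle_form_def conj_dlog_def rotated_x_def algebra_simps)
qed

lemma has_ext_deriv_conj_dlog:
  assumes "l2 f differentiable (at (fst p))" "n2 f differentiable (at (fst p))"
  shows "has_ext_deriv (conj_dlog f)
    (\<lambda>X Y. - flat_laplacian (\<lambda>q. ln (f q)) (fst p) * wedge11 dx dy X Y) p"
proof (rule has_ext_deriv_eq_rhs)
  show "has_ext_deriv (conj_dlog f) (\<lambda>X Y.
      (wedge11 (\<lambda>v. partial_x (l2 f) (fst p) * dx v + partial_y (l2 f) (fst p) * dy v) dx X Y
        + l2 f (fst p) * 0) +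
      (wedge11 (\<lambda>v. partial_x (n2 f) (fst p) * dx v + partial_y (n2 f) (fst p) * dy v) dy X Y
        + n2 f (fst p) * 0)) p"
    unfolding conj_dlog_def[abs_def]
    by (rule has_ext_deriv_add[OF
          has_ext_deriv_scale[OF has_derivative_pullback[OF assms(1)] has_ext_deriv_const]
          has_ext_deriv_scale[OF has_derivative_pullback[OF assms(2)] has_ext_deriv_const]])
next
  have "partial_y (partial_y (\<lambda>q. ln (f q))) (fst p) = partial_y (l2 f) (fst p)"
    by (simp add: l2_def[abs_def])
  moreover have "partial_x (partial_x (\<lambda>q. ln (f q))) (fst p) = - partial_x (n2 f) (fst p)"
  proof -
    have "((\<lambda>q. - n2 f q) has_derivative (\<lambda>v. - dir_deriv (n2 f) (fst p) v)) (at (fst p))"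
      by (rule has_derivative_minus[OF differentiable_imp_has_derivative[OF assms(2)]])
    then have "((\<lambda>q. partial_x (\<lambda>q. ln (f q)) q) has_derivative
        (\<lambda>v. - dir_deriv (n2 f) (fst p) v)) (at (fst p))"
      by (simp add: n2_def)
    from dir_deriv_eqI[OF this] show ?thesis
      by (simp only: partial_x_def[of "n2 f"] partial_x_def[of "partial_x (\<lambda>q. ln (f q))"])
  qed
  ultimately show
    "(wedge11 (\<lambda>v. partial_x (l2 f) (fst p) * dx v + partial_y (l2 f) (fst p) * dy v) dx X Y
        + l2 f (fst p) * 0) +
      (wedge11 (\<lambda>v. partial_x (n2 f) (fst p) * dx v + partial_y (n2 f) (fst p) * dy v) dy X Y
        + n2 f (fst p) * 0)
     = - flat_laplacian (\<lambda>q. ln (f q)) (fst p) * wedge11 dx dy X Y" for X Y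
    by (simp add: flat_laplacian_def wedge11_def algebra_simps)
qed

section \<open>Skew matrices that commute with a complex structure\<close>

text \<open>
The real \<open>4 \<times> 4\<close> matrices in \<open>so(4)\<close> that commute with the complex structure \<open>e\<^sub>1 \<mapsto> e\<^sub>2\<close>,
\<open>e\<^sub>4 \<mapsto> e\<^sub>3\<close>, that is, the Lie algebra \<open>u(2)\<close>. Connection and curvature of a Kaehler metric take
values in it, so four entries determine all sixteen.
\<close>

definition u2_matrix :: "real \<Rightarrow> real \<Rightarrow> real \<Rightarrow> real \<Rightarrow> 4 \<Rightarrow> 4 \<Rightarrow> real"
  where "u2_matrix a b c d i j = (
    if i = 1 then (if j = 2 then a else if j = 3 then - c else if j = 4 then b else 0)
    else if i = 2 then (if j = 1 then - a else if j = 3 then b else if j = 4 then c else 0)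
    else if i = 3 then (if j = 1 then c else if j = 2 then - b else if j = 4 then d else 0)
    else (if j = 1 then - b else if j = 2 then - c else if j = 3 then - d else 0))"

lemma u2_matrix_simps:
  "u2_matrix a b c d 1 1 = 0"
  "u2_matrix a b c d 1 2 = a"
  "u2_matrix a b c d 1 3 = - c"
  "u2_matrix a b c d 1 4 = b"
  "u2_matrix a b c d 2 1 = - a"
  "u2_matrix a b c d 2 2 = 0"
  "u2_matrix a b c d 2 3 = b"
  "u2_matrix a b c d 2 4 = c"
  "u2_matrix a b c d 3 1 = c"
  "u2_matrix a b c d 3 2 = - b"
  "u2_matrix a b c d 3 3 = 0"
  "u2_matrix a b c d 3 4 = d"
  "u2_matrix a b c d 4 1 = - b"
  "u2_matrix a b c d 4 2 = - c"
  "u2_matrix a b c d 4 3 = - d"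
  "u2_matrix a b c d 4 4 = 0"
  by (simp_all add: u2_matrix_def)

lemma u2_matrix_skew: "u2_matrix a b c d i j = - u2_matrix a b c d j i"
proof -
  have "\<forall>i j. u2_matrix a b c d i j = - u2_matrix a b c d j i"
    unfolding forall_4 by (simp add: u2_matrix_simps)
  then show ?thesis by blast
qed

lemma u2_matrix_add:
  "u2_matrix a b c d i j + u2_matrix a' b' c' d' i j = u2_matrix (a + a') (b + b') (c + c') (d + d') i j"
  by (simp add: u2_matrix_def)

lemma u2_matrix_entrywise:
  assumes "P (\<lambda>_. 0)" "P a" "P b" "P c" "P d"
    and "\<And>f. P f \<Longrightarrow> P (\<lambda>x. - f x)"
  shows "P (\<lambda>x. u2_matrix (a x) (b x) (c x) (d x) i j)"
proof -
  have "\<forall>i j. P (\<lambda>x. u2_matrix (a x) (b x) (c x) (d x) i j)"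
    unfolding forall_4 by (simp add: u2_matrix_simps assms)
  then show ?thesis by blast
qed

lemma has_ext_deriv_u2_matrix:
  assumes "has_ext_deriv a a' p" "has_ext_deriv b b' p" "has_ext_deriv c c' p"
    "has_ext_deriv d d' p"
  shows "has_ext_deriv (\<lambda>q X. u2_matrix (a q X) (b q X) (c q X) (d q X) i j)
    (\<lambda>X Y. u2_matrix (a' X Y) (b' X Y) (c' X Y) (d' X Y) i j) p"
proof -
  have zero: "has_ext_deriv (\<lambda>_ _. 0) (\<lambda>_ _. 0) p" by (rule has_ext_deriv_const)
  have neg: "has_ext_deriv (\<lambda>q X. - \<alpha> q X) (\<lambda>X Y. - \<omega> X Y) p" if "has_ext_deriv \<alpha> \<omega> p" for \<alpha> \<omega>
    using has_ext_deriv_diff[OF zero that] by simp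
  have "\<forall>i j. has_ext_deriv (\<lambda>q X. u2_matrix (a q X) (b q X) (c q X) (d q X) i j)
    (\<lambda>X Y. u2_matrix (a' X Y) (b' X Y) (c' X Y) (d' X Y) i j) p"
    unfolding forall_4 by (simp add: u2_matrix_simps assms zero neg)
  then show ?thesis by blast
qed

text \<open>
The quadratic term of the second structure equation; it stays in \<open>u(2)\<close>.
\<close>

lemma wedge_square_u2_matrix:
  fixes a b c d :: "'a \<Rightarrow> real"
  shows "(\<Sum>m\<in>UNIV. wedge11 (\<lambda>X. u2_matrix (a X) (b X) (c X) (d X) i m)
      (\<lambda>X. u2_matrix (a X) (b X) (c X) (d X) m j) X Y) =
    u2_matrix (- 2 * wedge11 b c X Y) (wedge11 a c X Y - wedge11 c d X Y)
      (wedge11 b a X Y + wedge11 b d X Y) (- 2 * wedge11 b c X Y) i j"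
proof -
  have "\<forall>i j. (\<Sum>m\<in>UNIV. wedge11 (\<lambda>X. u2_matrix (a X) (b X) (c X) (d X) i m)
      (\<lambda>X. u2_matrix (a X) (b X) (c X) (d X) m j) X Y) =
    u2_matrix (- 2 * wedge11 b c X Y) (wedge11 a c X Y - wedge11 c d X Y)
      (wedge11 b a X Y + wedge11 b d X Y) (- 2 * wedge11 b c X Y) i j"
    unfolding forall_4 by (simp add: u2_matrix_simps sum_4 wedge11_def algebra_simps)
  then show ?thesis by blast
qed

section \<open>The structure equations of the metric\<close>

lemma open_half_plane: "open half_plane"
proof -
  have "half_plane = {..<0} \<times> UNIV" by (auto simp: half_plane_def)
  moreover have "open ({..<0 :: real} \<times> (UNIV :: real set))"
    by (intro open_Times open_lessThan open_UNIV)
  ultimately show ?thesis by (simp only:)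
qed

lemma bounded_linear_coordinates:
  "bounded_linear (\<lambda>p :: plane \<times> plane. height p)"
  "bounded_linear (\<lambda>p :: plane \<times> plane. angle p)"
  by (auto intro!: bounded_linear_intros)

locale metric_data =
  fixes U :: "plane set" and h H :: "plane \<Rightarrow> real"
  assumes open_U: "open U"
    and smooth_h: "smooth_on U h" and h_pos: "q \<in> U \<Longrightarrow> 0 < h q"
    and smooth_H: "smooth_on U H" and H_pos: "q \<in> U \<Longrightarrow> 0 < H q"
    and laplace_ln_H: "q \<in> U \<Longrightarrow> flat_laplacian (\<lambda>q. ln (H q)) q = 1 / 2 * (h q)\<^sup>2 + (H q)\<^sup>2"
begin

abbreviation M where "M \<equiv> U \<times> half_plane"

lemma open_M: "open M"
  by (intro open_Times open_U open_half_plane)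

lemma fst_in_U: "p \<in> M \<Longrightarrow> fst p \<in> U" by auto

lemma height_neg: "p \<in> M \<Longrightarrow> height p < 0" by (auto simp: half_plane_def)

lemma sinh_half_neq: "p \<in> M \<Longrightarrow> sinh (height p / 2) \<noteq> 0"
  and sinh_neq: "p \<in> M \<Longrightarrow> sinh (height p) \<noteq> 0"
  using height_neg by fastforce+

lemma h_neq: "p \<in> M \<Longrightarrow> h (fst p) \<noteq> 0"
  using h_pos[of "fst p"] by auto

lemma smooth_l2: "smooth_on U (l2 f)" and smooth_n2: "smooth_on U (n2 f)"
  if "smooth_on U f" "\<And>q. q \<in> U \<Longrightarrow> 0 < f q"
proof -
  have "smooth_on U (\<lambda>q. ln (f q))" by (rule smooth_on_ln[OF open_U that(2,1)])
  then show "smooth_on U (l2 f)" "smooth_on U (n2 f)"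
    unfolding l2_def[abs_def] n2_def[abs_def] partial_x_def partial_y_def
    by (rule smooth_on_dir_deriv, rule smooth_on_uminus[OF open_U smooth_on_dir_deriv])
qed

lemma smooth_rotated_gradients:
  "smooth_on U (l2 h)" "smooth_on U (n2 h)" "smooth_on U (l2 H)" "smooth_on U (n2 H)"
  by (rule smooth_l2[OF smooth_h h_pos] smooth_n2[OF smooth_h h_pos]
      smooth_l2[OF smooth_H H_pos] smooth_n2[OF smooth_H H_pos], assumption)+

lemmas smooth_pullback = smooth_h[THEN smooth_on_fst[OF open_U open_half_plane]]
  smooth_H[THEN smooth_on_fst[OF open_U open_half_plane]]
  smooth_rotated_gradients[THEN smooth_on_fst[OF open_U open_half_plane]]

lemmas smooth_coordinates = bounded_linear_coordinates[THEN smooth_on_linear[OF open_M]]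

lemma smooth_half_height: "smooth_on M (\<lambda>p. height p / 2)"
  using smooth_on_mult[OF open_M smooth_coordinates(1) smooth_on_const[of _ "1 / 2"]] by simp

lemmas smooth_intros = open_M smooth_on_add smooth_on_diff smooth_on_mult smooth_on_uminus
  smooth_on_scaleR smooth_on_const smooth_on_sinh smooth_on_cosh smooth_on_sin smooth_on_cos
  smooth_coordinates smooth_half_height smooth_pullback

lemma smooth_forms:
  "smooth_on M (\<lambda>p. rotated_x H p X)" "smooth_on M (\<lambda>p. rotated_y H p X)"
  "smooth_on M (\<lambda>p. angle_form H p X)" "smooth_on M (\<lambda>p. conj_dlog h p X)"
  "smooth_on M (\<lambda>p. theta3 H p X)" "smooth_on M (\<lambda>p. theta4 H p X)"
  unfolding rotated_x_def rotated_y_def angle_form_def conj_dlog_def theta3_eq theta4_eq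
  by (intro smooth_intros)+

lemma smooth_inverses:
  "smooth_on M (\<lambda>p. inverse (sinh (height p)))"
  "smooth_on M (\<lambda>p. inverse (sinh (height p / 2) * h (fst p)))"
  using sinh_neq sinh_half_neq h_neq by (intro smooth_on_inverse smooth_intros; simp)+

text \<open>
In terms of \<open>u\<close> and \<open>v\<close> the identities between the forms at a point become polynomial, without
trigonometric functions.
\<close>

lemma horizontal_components:
  "\<exists>u v. (\<forall>X. rotated_x H p X = u * dx X + v * dy X) \<and>
    (\<forall>X. rotated_y H p X = - v * dx X + u * dy X) \<and> (H (fst p))\<^sup>2 = u * u + v * v"
proof (intro exI conjI allI)
  let ?u = "H (fst p) * cos (angle p)" and ?v = "H (fst p) * sin (angle p)"
  show "rotated_x H p X = ?u * dx X + ?v * dy X" "rotated_y H p X = - ?v * dx X + ?u * dy X" for X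
    by (simp_all add: rotated_x_def rotated_y_def field_simps)
  have "?u * ?u + ?v * ?v = (H (fst p))\<^sup>2 * ((sin (angle p))\<^sup>2 + (cos (angle p))\<^sup>2)"
    unfolding power2_eq_square distrib_left by (simp only: mult_ac add.commute)
  then show "(H (fst p))\<^sup>2 = ?u * ?u + ?v * ?v"
    unfolding sin_cos_squared_add mult_1_right by (rule sym)
qed

lemma hyperbolic_double:
  fixes z :: real
  shows "sinh z = 2 * (sinh (z / 2) * cosh (z / 2))"
    and "cosh z = 1 + 2 * (sinh (z / 2) * sinh (z / 2))"
    and "cosh (z / 2) * cosh (z / 2) = 1 + sinh (z / 2) * sinh (z / 2)"
  using sinh_double[of "z / 2"] cosh_double[of "z / 2"] hyperbolic_pythagoras[of "z / 2"]
  by (simp_all add: power2_eq_square)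

context
  fixes p assumes p: "p \<in> M"
begin

lemmas H_diff = smooth_on_differentiable[OF smooth_H open_U fst_in_U[OF p]]
lemmas h_diff = smooth_on_differentiable[OF smooth_h open_U fst_in_U[OF p]]

lemmas ext_rotated_x = has_ext_deriv_rotated_x[OF H_diff H_pos[OF fst_in_U[OF p]]]
lemmas ext_rotated_y = has_ext_deriv_rotated_y[OF H_diff H_pos[OF fst_in_U[OF p]]]
lemmas ext_conj_dlog_h = has_ext_deriv_conj_dlog[OF
    smooth_on_differentiable[OF smooth_rotated_gradients(1) open_U fst_in_U[OF p]]
    smooth_on_differentiable[OF smooth_rotated_gradients(2) open_U fst_in_U[OF p]]]
lemmas ext_conj_dlog_H = has_ext_deriv_conj_dlog[OF
    smooth_on_differentiable[OF smooth_rotated_gradients(3) open_U fst_in_U[OF p]]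
    smooth_on_differentiable[OF smooth_rotated_gradients(4) open_U fst_in_U[OF p]]]

lemma ext_angle_form:
  "has_ext_deriv (angle_form H) (\<lambda>X Y. (1 / 2 * (h (fst p))\<^sup>2 + (H (fst p))\<^sup>2) * wedge11 dx dy X Y) p"
  unfolding angle_form_def[abs_def]
  by (rule has_ext_deriv_eq_rhs, rule has_ext_deriv_diff[OF has_ext_deriv_const
ext_conj_dlog_H])
     (simp add: laplace_ln_H[OF fst_in_U[OF p]] left_diff_distrib distrib_right)

lemma ext_theta4: "has_ext_deriv (theta4 H) (\<lambda>X Y. - wedge11 (angle_form H p) (rotated_y H p) X Y) p"
  unfolding theta4_eq[abs_def]
  by (rule has_ext_deriv_eq_rhs, rule has_ext_deriv_diff[OF has_ext_deriv_const ext_rotated_x]) simp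

lemma ext_theta3:
  "has_ext_deriv (theta3 H) (\<lambda>X Y. cosh (height p) * wedge11 dz (angle_form H p) X Y
    + sinh (height p) * (1 / 2 * (h (fst p))\<^sup>2 + (H (fst p))\<^sup>2) * wedge11 dx dy X Y
    - sinh (height p) * wedge11 dz (rotated_y H p) X Y
    + cosh (height p) * wedge11 (angle_form H p) (rotated_x H p) X Y) p"
  unfolding theta3_eq[abs_def]
  by (rule has_ext_deriv_eq_rhs, rule has_ext_deriv_diff[OF
        has_ext_deriv_scale[OF has_derivative_fiber(3) ext_angle_form]
        has_ext_deriv_scale[OF has_derivative_fiber(4) ext_rotated_y]])
     (simp add: wedge11_def field_simps)

end

text \<open>
The four independent connection forms are \<open>\<omega>\<^sub>3\<^sub>4 = fiber_rotation\<close>, \<open>\<omega>\<^sub>1\<^sub>2 = base_rotation\<close>,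
\<open>\<omega>\<^sub>1\<^sub>4 = (c/2) h dx\<close> and \<open>\<omega>\<^sub>2\<^sub>4 = (c/2) h dy\<close>. Note that \<open>fiber_rotation\<close> is \<open>\<theta>\<^sub>3\<close> with the
hyperbolic functions exchanged.
\<close>

definition fiber_rotation :: "plane \<times> plane \<Rightarrow> plane \<times> plane \<Rightarrow> real"
  where "fiber_rotation p X = cosh (height p) * angle_form H p X - sinh (height p) * rotated_y H p X"

definition base_rotation :: "plane \<times> plane \<Rightarrow> plane \<times> plane \<Rightarrow> real"
  where "base_rotation p X = conj_dlog h p X - 1 / 2 * fiber_rotation p X - 1 / 2 * angle_form H p X"

definition half_cosh_form :: "(plane \<times> plane \<Rightarrow> real) \<Rightarrow> plane \<times> plane \<Rightarrow> plane \<times> plane \<Rightarrow> real"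
  where "half_cosh_form \<beta> p X = 1 / 2 * (cosh (height p / 2) * h (fst p)) * \<beta> X"

definition base_form :: "(plane \<times> plane \<Rightarrow> real) \<Rightarrow> plane \<times> plane \<Rightarrow> plane \<times> plane \<Rightarrow> real"
  where "base_form \<beta> p X = sinh (height p / 2) * h (fst p) * \<beta> X"

definition coframe :: "4 \<Rightarrow> plane \<times> plane \<Rightarrow> plane \<times> plane \<Rightarrow> real"
  where "coframe i p = (if i = 1 then base_form dx p else if i = 2 then base_form dy p
    else if i = 3 then theta3 H p else theta4 H p)"

lemma coframe_simps:
  "coframe 1 = base_form dx" "coframe 2 = base_form dy" "coframe 3 = theta3 H" "coframe 4 = theta4 H"
  by (simp_all add: coframe_def fun_eq_iff)

definition connection :: "4 \<Rightarrow> 4 \<Rightarrow> plane \<times> plane \<Rightarrow> plane \<times> plane \<Rightarrow> real"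
  where "connection i j p X =
    u2_matrix (base_rotation p X) (half_cosh_form dx p X) (half_cosh_form dy p X) (fiber_rotation p X) i j"

context
  fixes p assumes p: "p \<in> M"
begin

lemma horizontal_derivative:
  "partial_x h (fst p) * dx v + partial_y h (fst p) * dy v
    = h (fst p) * (l2 h (fst p) * dy v - n2 h (fst p) * dx v)"
  using partial_ln[OF h_diff[OF p] h_pos[OF fst_in_U[OF p]]] by (simp add: field_simps)

lemma ext_base_form:
  "has_ext_deriv (base_form \<beta>) (\<lambda>X Y. h (fst p) *
    (1 / 2 * cosh (height p / 2) * wedge11 dz \<beta> X Y + sinh (height p / 2) *
      wedge11 (\<lambda>v. l2 h (fst p) * dy v - n2 h (fst p) * dx v) \<beta> X Y)) p"
  unfolding base_form_def[abs_def]
  by (rule has_ext_deriv_eq_rhs, rule has_ext_deriv_scale[OF has_derivative_mult[OF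
          has_derivative_fiber(5) has_derivative_pullback[OF h_diff[OF p]]] has_ext_deriv_const])
     (simp add: horizontal_derivative, simp add: wedge11_def field_simps)

lemma ext_half_cosh_form:
  "has_ext_deriv (half_cosh_form \<beta>) (\<lambda>X Y. 1 / 2 * h (fst p) *
    (1 / 2 * sinh (height p / 2) * wedge11 dz \<beta> X Y + cosh (height p / 2) *
      wedge11 (\<lambda>v. l2 h (fst p) * dy v - n2 h (fst p) * dx v) \<beta> X Y)) p"
  unfolding half_cosh_form_def[abs_def]
  by (rule has_ext_deriv_eq_rhs, rule has_ext_deriv_scale[OF has_derivative_mult_right[OF
          has_derivative_mult[OF has_derivative_fiber(6) has_derivative_pullback[OF h_diff[OF p]]]]
          has_ext_deriv_const])
     (simp add: horizontal_derivative, simp add: wedge11_def field_simps)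

text \<open>
By \<open>\<Delta> ln H - H\<^sup>2 = h\<^sup>2/2\<close> only \<open>h\<close> occurs in the coefficient of \<open>dx \<and> dy\<close>.
\<close>

lemma ext_fiber_rotation:
  "has_ext_deriv fiber_rotation (\<lambda>X Y. wedge11 (theta4 H p) (theta3 H p) X Y
    + 1 / 2 * cosh (height p) * (h (fst p))\<^sup>2 * wedge11 dx dy X Y) p"
proof (rule has_ext_deriv_eq_rhs)
  show "has_ext_deriv fiber_rotation (\<lambda>X Y.
      (wedge11 (\<lambda>v. sinh (height p) * dz v) (angle_form H p) X Y + cosh (height p) *
        ((1 / 2 * (h (fst p))\<^sup>2 + (H (fst p))\<^sup>2) * wedge11 dx dy X Y))
      - (wedge11 (\<lambda>v. cosh (height p) * dz v) (rotated_y H p) X Y + sinh (height p) *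
        - wedge11 (angle_form H p) (rotated_x H p) X Y)) p"
    unfolding fiber_rotation_def[abs_def]
    by (rule has_ext_deriv_diff[OF
        has_ext_deriv_scale[OF has_derivative_fiber(4) ext_angle_form[OF p]]
        has_ext_deriv_scale[OF has_derivative_fiber(3) ext_rotated_y[OF p]]])
next
  fix X Y
  obtain u v where uv: "\<And>X. rotated_x H p X = u * dx X + v * dy X"
    "\<And>X. rotated_y H p X = - v * dx X + u * dy X" "(H (fst p))\<^sup>2 = u * u + v * v"
    using horizontal_components[of p] by blast
  show "(wedge11 (\<lambda>v. sinh (height p) * dz v) (angle_form H p) X Y + cosh (height p) *
        ((1 / 2 * (h (fst p))\<^sup>2 + (H (fst p))\<^sup>2) * wedge11 dx dy X Y))
      - (wedge11 (\<lambda>v. cosh (height p) * dz v) (rotated_y H p) X Y + sinh (height p) *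
        - wedge11 (angle_form H p) (rotated_x H p) X Y) =
    wedge11 (theta4 H p) (theta3 H p) X Y
    + 1 / 2 * cosh (height p) * (h (fst p))\<^sup>2 * wedge11 dx dy X Y"
    by (simp add: wedge11_def theta3_eq theta4_eq uv field_simps)
qed

lemma ext_base_rotation:
  "has_ext_deriv base_rotation (\<lambda>X Y.
    - (flat_laplacian (\<lambda>q. ln (h q)) (fst p) + 1 / 4 * cosh (height p) * (h (fst p))\<^sup>2
        + 1 / 4 * (h (fst p))\<^sup>2 + 1 / 2 * (H (fst p))\<^sup>2) * wedge11 dx dy X Y
    - 1 / 2 * wedge11 (theta4 H p) (theta3 H p) X Y) p"
  unfolding base_rotation_def[abs_def]
  by (rule has_ext_deriv_eq_rhs, rule has_ext_deriv_diff[OF has_ext_deriv_diff[OF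
        ext_conj_dlog_h[OF p]
        has_ext_deriv_scale[OF has_derivative_const ext_fiber_rotation]]
        has_ext_deriv_scale[OF has_derivative_const ext_angle_form[OF p]]])
     (simp_all add: wedge11_def field_simps)

text \<open>
Oriented so that rewriting removes all powers of \<open>c\<close> above the first.
\<close>

lemma hyperbolic_rules:
  "cosh (height p / 2) * cosh (height p / 2) = 1 + sinh (height p / 2) * sinh (height p / 2)"
  "cosh (height p / 2) * (cosh (height p / 2) * w) = w + sinh (height p / 2) * (sinh (height p / 2) * w)"
proof -
  show *: "cosh (height p / 2) * cosh (height p / 2)
      = 1 + sinh (height p / 2) * sinh (height p / 2)"
    by (rule hyperbolic_double(3))
  show "cosh (height p / 2) * (cosh (height p / 2) * w)
      = w + sinh (height p / 2) * (sinh (height p / 2) * w)"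
    unfolding mult.assoc[symmetric] * distrib_right mult_1_left ..
qed

lemma structure_equations:
  "ext_deriv1 (coframe i) p X Y = - (\<Sum>j\<in>UNIV. wedge11 (connection i j p) (coframe j p) X Y)"
proof -
  obtain u v where uv: "\<And>X. rotated_x H p X = u * dx X + v * dy X"
    "\<And>X. rotated_y H p X = - v * dx X + u * dy X" "(H (fst p))\<^sup>2 = u * u + v * v"
    using horizontal_components[of p] by blast
  note S = wedge11_def base_form_def half_cosh_form_def fiber_rotation_def base_rotation_def conj_dlog_def
    theta3_eq theta4_eq uv hyperbolic_double(1,2)[of "height p"]
  have 1: "ext_deriv1 (base_form dx) p X Y = - wedge11 (base_rotation p) (base_form dy p) X Y
      + wedge11 (half_cosh_form dy p) (theta3 H p) X Y - wedge11 (half_cosh_form dx p) (theta4 H p) X Y"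
    unfolding has_ext_derivD(1)[OF ext_base_form] S
    by (simp add: field_simps, simp add: hyperbolic_rules field_simps)
  have 2: "ext_deriv1 (base_form dy) p X Y = wedge11 (base_rotation p) (base_form dx p) X Y
      - wedge11 (half_cosh_form dx p) (theta3 H p) X Y - wedge11 (half_cosh_form dy p) (theta4 H p) X Y"
    unfolding has_ext_derivD(1)[OF ext_base_form] S
    by (simp add: field_simps, simp add: hyperbolic_rules field_simps)
  have 3: "ext_deriv1 (theta3 H) p X Y = - wedge11 (half_cosh_form dy p) (base_form dx p) X Y
      + wedge11 (half_cosh_form dx p) (base_form dy p) X Y - wedge11 (fiber_rotation p) (theta4 H p) X Y"
    unfolding has_ext_derivD(1)[OF ext_theta3[OF p]] S
    by (simp add: power2_eq_square field_simps)
  have 4: "ext_deriv1 (theta4 H) p X Y = wedge11 (half_cosh_form dx p) (base_form dx p) X Y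
      + wedge11 (half_cosh_form dy p) (base_form dy p) X Y + wedge11 (fiber_rotation p) (theta3 H p) X Y"
    unfolding has_ext_derivD(1)[OF ext_theta4[OF p]] S
    by (simp add: field_simps, simp add: hyperbolic_rules field_simps)
  have "\<forall>i. ext_deriv1 (coframe i) p X Y = - (\<Sum>j\<in>UNIV. wedge11 (connection i j p) (coframe j p) X Y)"
    unfolding forall_4 sum_4 coframe_simps 1 2 3 4
    by (simp add: wedge11_def connection_def u2_matrix_simps)
  then show ?thesis by blast
qed

text \<open>
The entries of the curvature matrix in the coframe. The first coefficient is a quotient because the
differential of \<open>base_rotation\<close> yields a multiple of \<open>dx \<and> dy\<close>, and
\<open>e\<^sub>1 \<and> e\<^sub>2 = (s h)\<^sup>2 dx \<and> dy\<close>; it contributes to the eigenvalue of the Ricci tensor on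
\<open>e\<^sub>1, e\<^sub>2\<close>.
\<close>

definition curvature_form :: "4 \<Rightarrow> 4 \<Rightarrow> plane \<times> plane \<Rightarrow> plane \<times> plane \<Rightarrow> real"
  where "curvature_form i j X Y = u2_matrix
    (- ((flat_laplacian (\<lambda>q. ln (h q)) (fst p) + 1 / 4 * cosh (height p) * (h (fst p))\<^sup>2
        + 1 / 4 * (h (fst p))\<^sup>2 + 1 / 2 * (H (fst p))\<^sup>2
        + 1 / 2 * (cosh (height p / 2) * h (fst p))\<^sup>2)
          / (sinh (height p / 2) * h (fst p))\<^sup>2) * wedge11 (base_form dx p) (base_form dy p) X Y
      - 1 / 2 * wedge11 (theta4 H p) (theta3 H p) X Y)
    (1 / 4 * (wedge11 (theta4 H p) (base_form dx p) X Y + wedge11 (theta3 H p) (base_form dy p) X Y))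
    (1 / 4 * (wedge11 (theta4 H p) (base_form dy p) X Y - wedge11 (theta3 H p) (base_form dx p) X Y))
    (wedge11 (theta4 H p) (theta3 H p) X Y + 1 / 2 * wedge11 (base_form dx p) (base_form dy p) X Y) i j"

text \<open>
Entry by entry (\<open>a\<close>, \<open>b\<close>, \<open>c\<close>, \<open>d\<close> below, in the order of \<open>u2_matrix\<close>) the differential of the connection
form and the quadratic term are added; the horizontal terms of the off-diagonal entries \<open>b\<close> and
\<open>c\<close> cancel by the half-argument formulas for \<open>sinh\<close> and \<open>cosh\<close>.
\<close>

lemma curvature_equations:
  "ext_deriv1 (connection i j) p X Y
    + (\<Sum>m\<in>UNIV. wedge11 (connection i m p) (connection m j p) X Y) = curvature_form i j X Y"
proof -
  obtain u v where uv: "\<And>X. rotated_x H p X = u * dx X + v * dy X"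
    "\<And>X. rotated_y H p X = - v * dx X + u * dy X" "(H (fst p))\<^sup>2 = u * u + v * v"
    using horizontal_components[of p] by blast
  note S = wedge11_def base_form_def half_cosh_form_def fiber_rotation_def base_rotation_def conj_dlog_def
    theta3_eq theta4_eq uv hyperbolic_double(1,2)[of "height p"]
  have b: "1 / 2 * h (fst p) *
      (1 / 2 * sinh (height p / 2) * wedge11 dz dx X Y + cosh (height p / 2) *
        wedge11 (\<lambda>v. l2 h (fst p) * dy v - n2 h (fst p) * dx v) dx X Y)
      + (wedge11 (base_rotation p) (half_cosh_form dy p) X Y - wedge11 (half_cosh_form dy p) (fiber_rotation p) X Y) =
    1 / 4 * (wedge11 (theta4 H p) (base_form dx p) X Y + wedge11 (theta3 H p) (base_form dy p) X Y)"
    unfolding S by (simp add: field_simps, simp add: hyperbolic_rules field_simps)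
  have c: "1 / 2 * h (fst p) *
      (1 / 2 * sinh (height p / 2) * wedge11 dz dy X Y + cosh (height p / 2) *
        wedge11 (\<lambda>v. l2 h (fst p) * dy v - n2 h (fst p) * dx v) dy X Y)
      + (wedge11 (half_cosh_form dx p) (base_rotation p) X Y + wedge11 (half_cosh_form dx p) (fiber_rotation p) X Y) =
    1 / 4 * (wedge11 (theta4 H p) (base_form dy p) X Y - wedge11 (theta3 H p) (base_form dx p) X Y)"
    unfolding S by (simp add: field_simps, simp add: hyperbolic_rules field_simps)
  have d: "wedge11 (theta4 H p) (theta3 H p) X Y
      + 1 / 2 * cosh (height p) * (h (fst p))\<^sup>2 * wedge11 dx dy X Y
      + - 2 * wedge11 (half_cosh_form dx p) (half_cosh_form dy p) X Y =
    wedge11 (theta4 H p) (theta3 H p) X Y + 1 / 2 * wedge11 (base_form dx p) (base_form dy p) X Y"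
    unfolding wedge11_def base_form_def half_cosh_form_def hyperbolic_double(2)[of "height p"]
    by (simp add: power2_eq_square field_simps, simp add: hyperbolic_rules field_simps)
  have nz: "(sinh (height p / 2) * h (fst p))\<^sup>2 \<noteq> 0"
    using sinh_half_neq[OF p] h_neq[OF p] by simp
  have "wedge11 (base_form dx p) (base_form dy p) X Y =
      (sinh (height p / 2) * h (fst p))\<^sup>2 * wedge11 dx dy X Y"
    by (simp add: wedge11_def base_form_def power2_eq_square field_simps)
  then have K: "- (k / (sinh (height p / 2) * h (fst p))\<^sup>2) * wedge11 (base_form dx p) (base_form dy p) X Y
      = - k * wedge11 dx dy X Y" for k
    using nz by simp
  have a: "- (flat_laplacian (\<lambda>q. ln (h q)) (fst p) + 1 / 4 * cosh (height p) * (h (fst p))\<^sup>2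
        + 1 / 4 * (h (fst p))\<^sup>2 + 1 / 2 * (H (fst p))\<^sup>2) * wedge11 dx dy X Y
      - 1 / 2 * wedge11 (theta4 H p) (theta3 H p) X Y
      + - 2 * wedge11 (half_cosh_form dx p) (half_cosh_form dy p) X Y =
    - ((flat_laplacian (\<lambda>q. ln (h q)) (fst p) + 1 / 4 * cosh (height p) * (h (fst p))\<^sup>2
        + 1 / 4 * (h (fst p))\<^sup>2 + 1 / 2 * (H (fst p))\<^sup>2
        + 1 / 2 * (cosh (height p / 2) * h (fst p))\<^sup>2)
          / (sinh (height p / 2) * h (fst p))\<^sup>2) * wedge11 (base_form dx p) (base_form dy p) X Y
      - 1 / 2 * wedge11 (theta4 H p) (theta3 H p) X Y"
    unfolding K by (simp add: wedge11_def half_cosh_form_def power2_eq_square field_simps)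
  have "ext_deriv1 (connection i j) p X Y
      + (\<Sum>m\<in>UNIV. wedge11 (connection i m p) (connection m j p) X Y) =
    u2_matrix
     (- (flat_laplacian (\<lambda>q. ln (h q)) (fst p) + 1 / 4 * cosh (height p) * (h (fst p))\<^sup>2
        + 1 / 4 * (h (fst p))\<^sup>2 + 1 / 2 * (H (fst p))\<^sup>2) * wedge11 dx dy X Y
      - 1 / 2 * wedge11 (theta4 H p) (theta3 H p) X Y
      + - 2 * wedge11 (half_cosh_form dx p) (half_cosh_form dy p) X Y)
     (1 / 2 * h (fst p) *
      (1 / 2 * sinh (height p / 2) * wedge11 dz dx X Y + cosh (height p / 2) *
        wedge11 (\<lambda>v. l2 h (fst p) * dy v - n2 h (fst p) * dx v) dx X Y)
      + (wedge11 (base_rotation p) (half_cosh_form dy p) X Y - wedge11 (half_cosh_form dy p) (fiber_rotation p) X Y))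
     (1 / 2 * h (fst p) *
      (1 / 2 * sinh (height p / 2) * wedge11 dz dy X Y + cosh (height p / 2) *
        wedge11 (\<lambda>v. l2 h (fst p) * dy v - n2 h (fst p) * dx v) dy X Y)
      + (wedge11 (half_cosh_form dx p) (base_rotation p) X Y + wedge11 (half_cosh_form dx p) (fiber_rotation p) X Y))
     (wedge11 (theta4 H p) (theta3 H p) X Y
      + 1 / 2 * cosh (height p) * (h (fst p))\<^sup>2 * wedge11 dx dy X Y
      + - 2 * wedge11 (half_cosh_form dx p) (half_cosh_form dy p) X Y) i j"
    unfolding connection_def[abs_def]
      has_ext_derivD(1)[OF has_ext_deriv_u2_matrix[OF ext_base_rotation ext_half_cosh_form ext_half_cosh_form ext_fiber_rotation]]
      wedge_square_u2_matrix u2_matrix_add ..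
  then show ?thesis unfolding curvature_form_def a b c d .
qed

end

section \<open>The dual frame\<close>

text \<open>
The lifts of the coordinate fields of the base along which \<open>\<theta>\<^sub>3\<close> and \<open>\<theta>\<^sub>4\<close> vanish; scaled by
\<open>1/(s h)\<close> they are the first two vectors of the dual frame.
\<close>

definition lift_x :: "plane \<times> plane \<Rightarrow> plane \<times> plane"
  where "lift_x p = ((1, 0), (0, 0)) + (H (fst p) * cos (angle p)) *\<^sub>R ((0, 0), (1, 0))
    + (l2 H (fst p) - H (fst p) * sin (angle p) * cosh (height p) * inverse (sinh (height p)))
      *\<^sub>R ((0, 0), (0, 1))"

definition lift_y :: "plane \<times> plane \<Rightarrow> plane \<times> plane"
  where "lift_y p = ((0, 1), (0, 0)) + (H (fst p) * sin (angle p)) *\<^sub>R ((0, 0), (1, 0))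
    + (n2 H (fst p) + H (fst p) * cos (angle p) * cosh (height p) * inverse (sinh (height p)))
      *\<^sub>R ((0, 0), (0, 1))"

abbreviation vert_z :: "plane \<times> plane" where "vert_z \<equiv> ((0, 0), (1, 0))"

definition vert_t :: "plane \<times> plane \<Rightarrow> plane \<times> plane"
  where "vert_t p = inverse (sinh (height p)) *\<^sub>R ((0, 0), (0, 1))"

definition frame :: "4 \<Rightarrow> plane \<times> plane \<Rightarrow> plane \<times> plane"
  where "frame i p = (if i = 1 then inverse (sinh (height p / 2) * h (fst p)) *\<^sub>R lift_x p
    else if i = 2 then inverse (sinh (height p / 2) * h (fst p)) *\<^sub>R lift_y p
    else if i = 3 then vert_t p else vert_z)"

lemma smooth_frame_fields:
  "smooth_on M lift_x" "smooth_on M lift_y" "smooth_on M vert_t" "smooth_on M (\<lambda>_. vert_z)"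
  unfolding lift_x_def[abs_def] lift_y_def[abs_def] vert_t_def[abs_def]
  by (intro smooth_intros smooth_inverses)+

lemma frame_simps:
  "frame 1 = (\<lambda>p. inverse (sinh (height p / 2) * h (fst p)) *\<^sub>R lift_x p)"
  "frame 2 = (\<lambda>p. inverse (sinh (height p / 2) * h (fst p)) *\<^sub>R lift_y p)"
  "frame 3 = vert_t" "frame 4 = (\<lambda>_. vert_z)"
  by (simp_all add: frame_def fun_eq_iff)

lemma linear_coframe: "linear (coframe i p)"
proof -
  have "\<forall>i. linear (coframe i p)"
    unfolding forall_4 coframe_simps base_form_def[abs_def]
    by (intro conjI linear_real_cmult linear_coordinate_forms linear_theta3 linear_theta4)
  then show ?thesis by blast
qed

lemma linear_connection_forms:
  "linear (fiber_rotation p)" "linear (base_rotation p)" "linear (half_cosh_form dx p)" "linear (half_cosh_form dy p)"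
  unfolding fiber_rotation_def[abs_def] base_rotation_def[abs_def] half_cosh_form_def[abs_def]
  by (intro linear_real_cmult linear_compose_sub linear_conj_dlog linear_angle_form linear_rotated_y
      linear_coordinate_forms)+

context
  fixes p assumes p: "p \<in> M"
begin

lemma forms_on_frame:
  "dx (lift_x p) = 1" "dy (lift_x p) = 0" "theta3 H p (lift_x p) = 0" "theta4 H p (lift_x p) = 0"
  "dx (lift_y p) = 0" "dy (lift_y p) = 1" "theta3 H p (lift_y p) = 0" "theta4 H p (lift_y p) = 0"
  "dx (vert_t p) = 0" "dy (vert_t p) = 0" "theta3 H p (vert_t p) = 1" "theta4 H p (vert_t p) = 0"
  "dx vert_z = 0" "dy vert_z = 0" "theta3 H p vert_z = 0" "theta4 H p vert_z = 1"
  using sinh_neq[OF p]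
  by (simp_all add: lift_x_def lift_y_def vert_t_def theta3_eq theta4_eq angle_form_def conj_dlog_def
      rotated_x_def rotated_y_def dx_def dy_def dz_def dt_def field_simps)

lemma decomposition:
  "X = dx X *\<^sub>R lift_x p + dy X *\<^sub>R lift_y p + theta3 H p X *\<^sub>R vert_t p + theta4 H p X *\<^sub>R vert_z"
  using sinh_neq[OF p]
  by (simp add: prod_eq_iff lift_x_def lift_y_def vert_t_def theta3_eq theta4_eq angle_form_def
      conj_dlog_def rotated_x_def rotated_y_def dx_def dy_def dz_def dt_def field_simps)

lemma eq_by_forms:
  assumes "dx X = dx Y" "dy X = dy Y" "theta3 H p X = theta3 H p Y" "theta4 H p X = theta4 H p Y"
  shows "X = Y"
  by (subst decomposition, subst (2) decomposition) (simp only: assms)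

end

lemma metric_coframe: "metric_g h H p X Y = (\<Sum>i\<in>UNIV. coframe i p X * coframe i p Y)"
  unfolding sum_4 coframe_simps
  by (cases p) (simp add: metric_g_def g_Sigma_def sinh_half_sq_def base_form_def power2_eq_square
      algebra_simps)

context
  fixes p assumes p: "p \<in> M"
begin

lemma scale_neq: "sinh (height p / 2) * h (fst p) \<noteq> 0"
  using sinh_half_neq[OF p] h_neq[OF p] by simp

lemma scale_cancel:
  "sinh (height p / 2) * h (fst p) * a * inverse (sinh (height p / 2) * h (fst p)) = a"
  by (simp only: mult.commute[of _ a] mult.assoc right_inverse[OF scale_neq, unfolded mult.assoc] mult_1_right)

lemma coframe_frame: "coframe i p (frame j p) = (if i = j then 1 else 0)"
proof -
  have "\<forall>i j. coframe i p (frame j p) = (if i = j then 1 else 0)"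
    unfolding forall_4 coframe_simps frame_simps base_form_def
    by (simp add: right_inverse[OF scale_neq] del: inverse_mult_distrib add: linear_scale[OF linear_coordinate_forms(1)] linear_scale[OF linear_coordinate_forms(2)]
        linear_scale[OF linear_theta3] linear_scale[OF linear_theta4] forms_on_frame[OF p])
  then show ?thesis by blast
qed

lemma frame_expansion: "(\<Sum>i\<in>UNIV. coframe i p X *\<^sub>R frame i p) = X"
proof -
  have "(\<Sum>i\<in>UNIV. coframe i p X *\<^sub>R frame i p) = dx X *\<^sub>R lift_x p + dy X *\<^sub>R lift_y p
      + theta3 H p X *\<^sub>R vert_t p + theta4 H p X *\<^sub>R vert_z"
    unfolding sum_4 coframe_simps frame_simps base_form_def scaleR_scaleR scale_cancel by simp
  then show ?thesis
    unfolding decomposition[OF p, symmetric] .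
qed

lemma connection_differentiable: "(\<lambda>q. connection i j q X) differentiable (at p)"
  using has_ext_deriv_u2_matrix[OF ext_base_rotation[OF p] ext_half_cosh_form[OF p] ext_half_cosh_form[OF p] ext_fiber_rotation[OF p],
      of dx dy i j]
  unfolding has_ext_deriv_def connection_def by blast

end

lemma linear_connection: "linear (connection i j p)"
  unfolding connection_def[abs_def]
  by (rule u2_matrix_entrywise[where P = linear])
     (auto intro: linear_connection_forms linear_zero linear_compose_neg)

lemma connection_skew: "connection i j p X = - connection j i p X"
  unfolding connection_def by (rule u2_matrix_skew)

lemma smooth_coframe: "smooth_on M (\<lambda>p. coframe i p X)"
proof -
  have "\<forall>i. smooth_on M (\<lambda>p. coframe i p X)"
    unfolding forall_4 coframe_simps base_form_def
    by (intro conjI smooth_forms) (intro smooth_intros)+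
  then show ?thesis by blast
qed

lemma smooth_frame: "smooth_on M (frame i)"
proof -
  have "\<forall>i. smooth_on M (frame i)"
    unfolding forall_4 frame_simps
    by (intro conjI smooth_on_scaleR open_M smooth_inverses smooth_frame_fields)
  then show ?thesis by blast
qed

sublocale cartan: orthonormal_frame M "metric_g h H" coframe frame connection
  by (rule orthonormal_frame.intro)
     (rule open_M linear_coframe smooth_coframe smooth_frame coframe_frame frame_expansion
        metric_coframe linear_connection connection_differentiable connection_skew
        structure_equations; assumption?)+

lemma riemannian_metric: "riemannian_metric_on M (metric_g h H)"
  unfolding riemannian_metric_on_def
proof (intro conjI ballI allI impI)
  fix p X Y assume p: "p \<in> M"
  show "bilinear (metric_g h H p)"
    unfolding bilinear_def metric_coframe
    by (intro conjI allI; rule linearI;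
        simp only: linear_add[OF linear_coframe] linear_scale[OF linear_coframe] distrib_left
          distrib_right sum.distrib sum_distrib_left real_scaleR_def mult_ac)
  show "metric_g h H p X Y = metric_g h H p Y X"
    by (simp add: metric_coframe mult.commute)
  assume "X \<noteq> 0"
  have "metric_g h H p X X \<noteq> 0"
  proof
    assume "metric_g h H p X X = 0"
    then have "coframe k p X = 0" for k
      by (simp add: metric_coframe sum_nonneg_eq_0_iff)
    then have "X = 0"
      by (intro cartan.frame_eqI[OF p]) (simp add: linear_0[OF linear_coframe])
    with \<open>X \<noteq> 0\<close> show False by simp
  qed
  moreover have "0 \<le> metric_g h H p X X"
    unfolding metric_coframe by (intro sum_nonneg) simp
  ultimately show "0 < metric_g h H p X X" by simp
next
  fix X Y
  show "smooth_on M (\<lambda>p. metric_g h H p X Y)"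
    unfolding metric_coframe sum_4 by (intro smooth_on_add smooth_on_mult open_M smooth_coframe)
qed

section \<open>The two complex structures\<close>

text \<open>
It maps \<open>E\<^sub>1 \<mapsto> E\<^sub>2\<close> and \<open>E\<^sub>3 \<mapsto> \<sigma> E\<^sub>4\<close>; the sign \<open>\<sigma>\<close> distinguishes the Hermitian structure
(\<open>\<sigma> = 1\<close>) from the Kaehler structure (\<open>\<sigma> = -1\<close>), which induce opposite orientations.
\<close>

definition complex_structure :: "real \<Rightarrow> plane \<times> plane \<Rightarrow> plane \<times> plane \<Rightarrow> plane \<times> plane"
  where "complex_structure \<sigma> p X = dx X *\<^sub>R lift_y p - dy X *\<^sub>R lift_x p
    + (\<sigma> * theta3 H p X) *\<^sub>R vert_z - (\<sigma> * theta4 H p X) *\<^sub>R vert_t p"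

lemma linear_complex_structure: "linear (complex_structure \<sigma> p)"
  unfolding complex_structure_def[abs_def]
  by (rule linearI)
     (simp_all add: linear_add[OF linear_coordinate_forms(1)] linear_add[OF linear_coordinate_forms(2)]
        linear_add[OF linear_theta3] linear_add[OF linear_theta4]
        linear_scale[OF linear_coordinate_forms(1)] linear_scale[OF linear_coordinate_forms(2)]
        linear_scale[OF linear_theta3] linear_scale[OF linear_theta4] algebra_simps)

lemma smooth_complex_structure: "smooth_on M (\<lambda>p. complex_structure \<sigma> p X)"
  unfolding complex_structure_def
  by (intro smooth_on_add smooth_on_diff smooth_on_scaleR smooth_on_mult open_M smooth_on_const
      smooth_frame_fields smooth_forms)

lemma forms_complex_structure:
  assumes p: "p \<in> M"
  shows "dx (complex_structure \<sigma> p X) = - dy X" "dy (complex_structure \<sigma> p X) = dx X"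
    "theta3 H p (complex_structure \<sigma> p X) = - (\<sigma> * theta4 H p X)"
    "theta4 H p (complex_structure \<sigma> p X) = \<sigma> * theta3 H p X"
  unfolding complex_structure_def
    linear_add[OF linear_coordinate_forms(1)] linear_add[OF linear_coordinate_forms(2)]
    linear_diff[OF linear_coordinate_forms(1)] linear_diff[OF linear_coordinate_forms(2)]
    linear_add[OF linear_theta3] linear_add[OF linear_theta4]
    linear_diff[OF linear_theta3] linear_diff[OF linear_theta4]
    linear_scale[OF linear_coordinate_forms(1)] linear_scale[OF linear_coordinate_forms(2)]
    linear_scale[OF linear_theta3] linear_scale[OF linear_theta4] forms_on_frame[OF p]
  by simp_all

context
  fixes \<sigma> :: real assumes sign: "\<sigma> * \<sigma> = 1"
begin

lemma sign_cancel: "\<sigma> * (\<sigma> * a) = a"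
  using sign by (metis mult.assoc mult_1_left)

lemma complex_structure_square:
  assumes p: "p \<in> M"
  shows "complex_structure \<sigma> p (complex_structure \<sigma> p X) = - X"
  by (rule eq_by_forms[OF p])
     (simp_all add: forms_complex_structure[OF p] sign_cancel
        linear_neg[OF linear_coordinate_forms(1)] linear_neg[OF linear_coordinate_forms(2)]
        linear_neg[OF linear_theta3] linear_neg[OF linear_theta4])

lemma metric_complex_structure:
  assumes p: "p \<in> M"
  shows "metric_g h H p (complex_structure \<sigma> p X) (complex_structure \<sigma> p Y) = metric_g h H p X Y"
proof -
  have sign2: "\<sigma> * a * (\<sigma> * b) = a * b" for a b
    using sign by (simp only: mult.assoc mult.left_commute[of a] sign_cancel)
  show ?thesis
    by (simp add: metric_g_def g_Sigma_def forms_complex_structure[OF p] sign2)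
qed

lemma almost_hermitian: "almost_hermitian_on M (metric_g h H) (complex_structure \<sigma>)"
  unfolding almost_hermitian_on_def almost_complex_on_def
  by (intro conjI ballI allI riemannian_metric linear_complex_structure smooth_complex_structure
      complex_structure_square metric_complex_structure)

lemma ext_sign_theta4:
  assumes p: "p \<in> M"
  shows "has_ext_deriv (\<lambda>q X. \<sigma> * theta4 H q X)
    (\<lambda>X Y. - \<sigma> * wedge11 (angle_form H p) (rotated_y H p) X Y) p"
  by (rule has_ext_deriv_eq_rhs, rule has_ext_deriv_scale[OF has_derivative_const ext_theta4[OF p]])
     (simp add: wedge11_def algebra_simps)

text \<open>
It suffices to evaluate \<open>dx\<close>, \<open>dy\<close>, \<open>\<theta>\<^sub>3\<close> and \<open>\<theta>\<^sub>4\<close> on the Nijenhuis tensor. The forms \<open>dx\<close> and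
\<open>dy\<close> are closed. For the other two, the equations \<open>d3\<close> and \<open>d4\<close> below say that, modulo
\<open>\<theta>\<^sub>3 \<and> \<theta>\<^sub>4\<close> and \<open>dx \<and> dy\<close>, the differentials of \<open>\<theta>\<^sub>3\<close> and \<open>\<theta>\<^sub>4\<close> are \<open>\<theta>\<^sub>4 \<and> B / sinh z\<close> and
\<open>- \<theta>\<^sub>3 \<and> B / sinh z\<close>; so that of \<open>\<theta>\<^sub>3 + i \<sigma> \<theta>\<^sub>4\<close> is a multiple of
\<open>(\<theta>\<^sub>3 + i \<sigma> \<theta>\<^sub>4) \<and> B\<close> for either sign.
\<close>

lemma nijenhuis_zero:
  assumes p: "p \<in> M" and X: "X differentiable (at p)" and Y: "Y differentiable (at p)"
  shows "nijenhuis (complex_structure \<sigma>) X Y p = 0"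
proof -
  let ?J = "complex_structure \<sigma>" and ?N = "nijenhuis (complex_structure \<sigma>) X Y p"
  note nij = form_nijenhuis[where J = ?J, OF open_M p linear_complex_structure
      complex_structure_square[OF p] smooth_on_differentiable[OF smooth_complex_structure open_M p] X Y]
  note J = forms_complex_structure
  have neg_linear: "linear (\<lambda>X. - dx X)" "linear (\<lambda>X. - theta3 H q X)" "linear (\<lambda>X. \<sigma> * theta4 H q X)" for q
    by (intro linear_compose_neg linear_real_cmult linear_coordinate_forms linear_theta3 linear_theta4)+
  have ext_neg_theta3: "has_ext_deriv (\<lambda>q X. - theta3 H q X) (\<lambda>X Y. - ext_deriv1 (theta3 H) p X Y) p"
    using has_ext_deriv_diff[OF has_ext_deriv_const[of "\<lambda>_. 0"] ext_theta3[OF p]]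
    by (simp add: has_ext_derivD(1)[OF ext_theta3[OF p]])
  have ext_theta3': "has_ext_deriv (theta3 H) (\<lambda>X Y. ext_deriv1 (theta3 H) p X Y) p"
    using ext_theta3[OF p] by (simp add: has_ext_deriv_def)
  have "dx ?N = 0"
    using nij[of "\<lambda>_. dx" _ "\<lambda>_. dy", OF has_ext_deriv_const linear_coordinate_forms(1) _
        has_ext_deriv_const linear_coordinate_forms(2)] J(1,2) by simp
  moreover have "dy ?N = 0"
    using nij[of "\<lambda>_. dy" _ "\<lambda>_ X. - dx X", OF has_ext_deriv_const linear_coordinate_forms(2) _
        has_ext_deriv_const neg_linear(1)] J(1,2) by simp
  moreover have "theta3 H p ?N = 0" "\<sigma> * theta4 H p ?N = 0"
  proof -
    obtain u v where uv: "\<And>X. rotated_x H p X = u * dx X + v * dy X"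
      "\<And>X. rotated_y H p X = - v * dx X + u * dy X" "(H (fst p))\<^sup>2 = u * u + v * v"
      using horizontal_components[of p] by blast
    note forms = has_ext_derivD(1)[OF ext_theta3[OF p]]
    have N3: "theta3 H p ?N = ext_deriv1 (theta3 H) p (X p) (Y p)
        - ext_deriv1 (theta3 H) p (?J p (X p)) (?J p (Y p))
        - - \<sigma> * wedge11 (angle_form H p) (rotated_y H p) (?J p (X p)) (Y p)
        - - \<sigma> * wedge11 (angle_form H p) (rotated_y H p) (X p) (?J p (Y p))"
      by (rule nij[OF ext_theta3' linear_theta3 _ ext_sign_theta4[OF p] neg_linear(3)])
         (simp_all add: J sign_cancel)
    have N4: "\<sigma> * theta4 H p ?N = - \<sigma> * wedge11 (angle_form H p) (rotated_y H p) (X p) (Y p)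
        - - \<sigma> * wedge11 (angle_form H p) (rotated_y H p) (?J p (X p)) (?J p (Y p))
        - - ext_deriv1 (theta3 H) p (?J p (X p)) (Y p)
        - - ext_deriv1 (theta3 H) p (X p) (?J p (Y p))"
      by (rule nij[OF ext_sign_theta4[OF p] neg_linear(3) _ ext_neg_theta3 neg_linear(2)])
         (simp_all add: J sign_cancel)
    have d3: "sinh (height p) * ext_deriv1 (theta3 H) p V W =
        cosh (height p) * wedge11 (theta4 H p) (theta3 H p) V W
        + wedge11 (theta4 H p) (rotated_y H p) V W
        + 1 / 2 * (sinh (height p) * sinh (height p)) * (h (fst p))\<^sup>2 * wedge11 dx dy V W" for V W
    proof -
      have c2: "cosh (height p) * cosh (height p) = 1 + sinh (height p) * sinh (height p)"
        using hyperbolic_pythagoras[of "height p"] by (simp add: power2_eq_square)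
      have c2': "cosh (height p) * (cosh (height p) * a) =
          a + sinh (height p) * (sinh (height p) * a)" for a
        unfolding mult.assoc[symmetric] c2 distrib_right mult_1_left ..
      show ?thesis
        unfolding forms wedge11_def theta3_eq theta4_eq uv
        by (simp add: field_simps, simp add: c2 c2' field_simps)
    qed
    have d4: "sinh (height p) * wedge11 (angle_form H p) (rotated_y H p) V W =
        wedge11 (theta3 H p) (rotated_y H p) V W" for V W
      by (simp add: wedge11_def theta3_eq algebra_simps)
    have "sinh (height p) * (theta3 H p ?N) = 0"
      unfolding N3 right_diff_distrib d3 mult.left_commute[of "sinh (height p)" "- \<sigma>"] d4
      unfolding wedge11_def uv J[OF p] by (simp add: field_simps sign_cancel)
    then show "theta3 H p ?N = 0" using sinh_neq[OF p] by simp
    have "sinh (height p) * (\<sigma> * theta4 H p ?N) = 0"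
      unfolding N4 right_diff_distrib mult_minus_right d3 mult.left_commute[of "sinh (height p)" "- \<sigma>"] d4
      unfolding wedge11_def uv J[OF p] by (simp add: field_simps sign_cancel)
    then show "\<sigma> * theta4 H p ?N = 0" using sinh_neq[OF p] by simp
  qed
  moreover have "\<sigma> \<noteq> 0" using sign by auto
  ultimately show ?thesis
    by (intro eq_by_forms[OF p])
       (simp_all add: linear_0[OF linear_coordinate_forms(1)] linear_0[OF linear_coordinate_forms(2)]
          linear_0[OF linear_theta3] linear_0[OF linear_theta4])
qed

end

context
  fixes \<sigma> :: real assumes sign: "\<sigma> * \<sigma> = 1"
begin

section \<open>Kaehler forms and the Lee form\<close>

lemma hermitian: "hermitian_on M (metric_g h H) (complex_structure \<sigma>)"
  unfolding hermitian_on_def integrable_on_manifold_def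
  using almost_hermitian[OF sign] nijenhuis_zero[OF sign] smooth_on_differentiable[OF _ open_M] by blast

lemma kahler_form_eq:
  assumes p: "p \<in> M"
  shows "kahler_form (metric_g h H) (complex_structure \<sigma>) p X Y =
    wedge11 (base_form dx p) (base_form dy p) X Y + \<sigma> * wedge11 (theta3 H p) (theta4 H p) X Y"
  unfolding kahler_form_def metric_coframe sum_4 coframe_simps base_form_def
    forms_complex_structure[OF p] wedge11_def
  by (simp add: algebra_simps)

end

context
  fixes p assumes p: "p \<in> M"
begin

lemma ext_deriv2_base:
  "has_ext_deriv2 (\<lambda>q X Y. wedge11 (base_form dx q) (base_form dy q) X Y)
    (\<lambda>X Y Z. 1 / 2 * sinh (height p) * (h (fst p))\<^sup>2 * wedge12 dz (wedge11 dx dy) X Y Z) p"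
proof -
  have "wedge12 (base_form dy p) (\<lambda>X Y. h (fst p) *
        (1 / 2 * cosh (height p / 2) * wedge11 dz dx X Y + sinh (height p / 2) *
        wedge11 (\<lambda>v. l2 h (fst p) * dy v - n2 h (fst p) * dx v) dx X Y)) X Y Z
      - wedge12 (base_form dx p) (\<lambda>X Y. h (fst p) *
        (1 / 2 * cosh (height p / 2) * wedge11 dz dy X Y + sinh (height p / 2) *
        wedge11 (\<lambda>v. l2 h (fst p) * dy v - n2 h (fst p) * dx v) dy X Y)) X Y Z =
      1 / 2 * sinh (height p) * (h (fst p))\<^sup>2 * wedge12 dz (wedge11 dx dy) X Y Z" for X Y Z
    unfolding wedge12_def wedge11_def base_form_def hyperbolic_double(1)[of "height p"]
    by (simp add: power2_eq_square field_simps)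
  then show ?thesis
    by (rule has_ext_deriv2_eq_rhs[OF has_ext_deriv2_wedge[OF ext_base_form[OF p] ext_base_form[OF p]]])
qed

text \<open>
The same three-form as for the base. Here the equation \<open>\<Delta> ln H - H\<^sup>2 = h\<^sup>2/2\<close> is used: the part of
\<open>d\<theta>\<^sub>3\<close> along \<open>dx \<and> dy\<close> gives \<open>sinh z \<Delta> ln H\<close>, and \<open>- sinh z dz \<and> B\<close>, multiplied by the part \<open>A\<close> of
\<open>\<theta>\<^sub>4\<close>, gives \<open>- sinh z H\<^sup>2\<close>.
\<close>

lemma ext_deriv2_fiber:
  "has_ext_deriv2 (\<lambda>q X Y. wedge11 (theta3 H q) (theta4 H q) X Y)
    (\<lambda>X Y Z. 1 / 2 * sinh (height p) * (h (fst p))\<^sup>2 * wedge12 dz (wedge11 dx dy) X Y Z) p"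
proof -
  obtain u v where uv: "\<And>X. rotated_x H p X = u * dx X + v * dy X"
    "\<And>X. rotated_y H p X = - v * dx X + u * dy X" "(H (fst p))\<^sup>2 = u * u + v * v"
    using horizontal_components[of p] by blast
  have "wedge12 (theta4 H p) (\<lambda>X Y. cosh (height p) * wedge11 dz (angle_form H p) X Y
        + sinh (height p) * (1 / 2 * (h (fst p))\<^sup>2 + (H (fst p))\<^sup>2) * wedge11 dx dy X Y
        - sinh (height p) * wedge11 dz (rotated_y H p) X Y
        + cosh (height p) * wedge11 (angle_form H p) (rotated_x H p) X Y) X Y Z
      - wedge12 (theta3 H p) (\<lambda>X Y. - wedge11 (angle_form H p) (rotated_y H p) X Y) X Y Z =
      1 / 2 * sinh (height p) * (h (fst p))\<^sup>2 * wedge12 dz (wedge11 dx dy) X Y Z" for X Y Z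
    unfolding wedge12_def wedge11_def theta3_eq theta4_eq uv
    by (simp add: field_simps)
  then show ?thesis
    by (rule has_ext_deriv2_eq_rhs[OF has_ext_deriv2_wedge[OF ext_theta3[OF p] ext_theta4[OF p]]])
qed

lemma ext_deriv2_kahler_form:
  assumes sign: "\<sigma> * \<sigma> = 1"
  shows "ext_deriv2 (kahler_form (metric_g h H) (complex_structure \<sigma>)) p X Y Z =
    (1 + \<sigma>) * (1 / 2 * sinh (height p) * (h (fst p))\<^sup>2 * wedge12 dz (wedge11 dx dy) X Y Z)"
proof -
  have "ext_deriv2 (kahler_form (metric_g h H) (complex_structure \<sigma>)) p X Y Z =
      ext_deriv2 (\<lambda>q X Y. wedge11 (base_form dx q) (base_form dy q) X Y
        + \<sigma> * wedge11 (theta3 H q) (theta4 H q) X Y) p X Y Z"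
    by (rule ext_deriv2_cong[OF open_M p]) (rule kahler_form_eq[OF sign])
  also have "\<dots> = 1 / 2 * sinh (height p) * (h (fst p))\<^sup>2 * wedge12 dz (wedge11 dx dy) X Y Z
      + \<sigma> * (1 / 2 * sinh (height p) * (h (fst p))\<^sup>2 * wedge12 dz (wedge11 dx dy) X Y Z)"
    by (rule has_ext_deriv2D(1)[OF has_ext_deriv2_add[OF ext_deriv2_base
            has_ext_deriv2_cmult[OF ext_deriv2_fiber]]])
  finally show ?thesis by (simp add: algebra_simps)
qed

text \<open>
Uniqueness in the definition of the Lee form is seen on the frame: wedging with \<open>\<Omega>\<close> and evaluating
on a vector of one of the planes \<open>E\<^sub>1, E\<^sub>2\<close> and \<open>E\<^sub>3, E\<^sub>4\<close> together with a basis of the other plane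
recovers the value of the one-form on that vector.
\<close>

lemma lee_form_eq:
  "lee_form (metric_g h H) (complex_structure 1) p X = - alpha p * theta4 H p X"
proof -
  let ?\<Omega> = "kahler_form (metric_g h H) (complex_structure 1) p"
  have \<Omega>: "?\<Omega> = (\<lambda>X Y. wedge11 (base_form dx p) (base_form dy p) X Y + 1 * wedge11 (theta3 H p) (theta4 H p) X Y)"
    by (intro ext kahler_form_eq[OF _ p]) simp
  have "lee_form (metric_g h H) (complex_structure 1) p = (\<lambda>X. - alpha p * theta4 H p X)"
    unfolding lee_form_def
  proof (rule the_equality)
    have \<alpha>: "- alpha p * sinh (height p / 2) = cosh (height p / 2)"
      using sinh_half_neq[OF p] by (cases p) (auto simp: alpha_def)
    obtain u v where uv: "\<And>X. rotated_x H p X = u * dx X + v * dy X"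
      using horizontal_components[of p] by blast
    have "1 / 2 * sinh (height p) * (h (fst p))\<^sup>2 * wedge12 dz (wedge11 dx dy) X Y Z =
        wedge12 (\<lambda>X. - alpha p * theta4 H p X) ?\<Omega> X Y Z" for X Y Z
    proof -
      have s: "1 / 2 * sinh (height p) =
          - alpha p * (sinh (height p / 2) * sinh (height p / 2))"
        unfolding hyperbolic_double(1)[of "height p"] \<alpha>[symmetric] by simp
      show ?thesis
        unfolding \<Omega> s wedge12_def wedge11_def base_form_def theta4_eq uv
        by (simp add: power2_eq_square algebra_simps)
    qed
    then show "linear (\<lambda>X. - alpha p * theta4 H p X) \<and>
      (\<forall>X Y Z. ext_deriv2 (kahler_form (metric_g h H) (complex_structure 1)) p X Y Z =
        2 * wedge12 (\<lambda>X. - alpha p * theta4 H p X) ?\<Omega> X Y Z)"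
      by (simp add: ext_deriv2_kahler_form linear_real_cmult[OF linear_theta4, of "- alpha p", simplified])
    then have eq: "ext_deriv2 (kahler_form (metric_g h H) (complex_structure 1)) p X Y Z =
        2 * wedge12 (\<lambda>X. - alpha p * theta4 H p X) ?\<Omega> X Y Z" for X Y Z by blast
    fix \<theta> assume \<theta>: "linear \<theta> \<and> (\<forall>X Y Z. ext_deriv2 (kahler_form (metric_g h H) (complex_structure 1)) p X Y Z =
        2 * wedge12 \<theta> ?\<Omega> X Y Z)"
    have "wedge12 \<theta> ?\<Omega> X Y Z = wedge12 (\<lambda>X. - alpha p * theta4 H p X) ?\<Omega> X Y Z" for X Y Z
      using eq[of X Y Z] \<theta>[THEN conjunct2, rule_format, of X Y Z] by linarith
    note W = this[unfolded \<Omega> wedge12_def wedge11_def base_form_def]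
    have nz: "sinh (height p / 2) * h (fst p) * (sinh (height p / 2) * h (fst p)) \<noteq> 0"
      using sinh_half_neq[OF p] h_neq[OF p] by simp
    have vals: "\<theta> (lift_x p) = 0" "\<theta> (lift_y p) = 0" "\<theta> (vert_t p) = 0"
      using W[of "lift_x p" "vert_t p" vert_z] W[of "lift_y p" "vert_t p" vert_z]
        W[of "vert_t p" "lift_x p" "lift_y p"] nz
      by (simp_all add: forms_on_frame[OF p])
    have "(\<theta> vert_z - - alpha p) *
        (sinh (height p / 2) * h (fst p) * (sinh (height p / 2) * h (fst p))) = 0"
      using W[of vert_z "lift_x p" "lift_y p"] by (simp add: forms_on_frame[OF p] algebra_simps)
    then have "\<theta> vert_z = - alpha p"
      using nz by (simp only: mult_eq_0_iff simp_thms right_minus_eq)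
    note vals = vals this
    show "\<theta> = (\<lambda>X. - alpha p * theta4 H p X)"
    proof
      fix X
      have "\<theta> X = \<theta> (dx X *\<^sub>R lift_x p + dy X *\<^sub>R lift_y p + theta3 H p X *\<^sub>R vert_t p + theta4 H p X *\<^sub>R vert_z)"
        by (rule arg_cong[OF decomposition[OF p]])
      also have "\<dots> = - alpha p * theta4 H p X"
        by (simp only: linear_add[OF \<theta>[THEN conjunct1]] linear_scale[OF \<theta>[THEN conjunct1]] vals) simp
      finally show "\<theta> X = - alpha p * theta4 H p X" .
    qed
  qed
  then show ?thesis by simp
qed

section \<open>The Ricci tensor\<close>

lemma linear_curvature_form: "linear (\<lambda>X. curvature_form p i j X Y)"
proof -
  have w: "linear (\<lambda>X. wedge11 \<alpha> \<beta> X Y)" if "linear \<alpha>" "linear \<beta>" for \<alpha> \<beta> :: "plane \<times> plane \<Rightarrow> real"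
    by (rule linearI) (simp_all add: wedge11_def linear_add[OF that(1)] linear_add[OF that(2)]
        linear_scale[OF that(1)] linear_scale[OF that(2)] algebra_simps)
  have e: "linear (base_form dx p)" "linear (base_form dy p)"
    using linear_coframe[of 1 p] linear_coframe[of 2 p] by (simp_all add: coframe_simps)
  show ?thesis
    unfolding curvature_form_def[OF p]
    by (rule u2_matrix_entrywise[where P = linear])
       (intro linear_zero linear_compose_neg linear_compose_add linear_compose_sub
          linear_real_cmult w e linear_theta3 linear_theta4; assumption)+
qed

text \<open>
A bilinear form of this shape is invariant under every rotation of the two planes, in particular
under both complex structures.
\<close>

lemma ricci_diagonal:
  "\<exists>r. \<forall>Y Z. ricci (metric_g h H) p Y Z = r * (dx Y * dx Z + dy Y * dy Z)
    - 3 / 2 * (theta3 H p Y * theta3 H p Z + theta4 H p Y * theta4 H p Z)"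
proof -
  define k where "k = - ((flat_laplacian (\<lambda>q. ln (h q)) (fst p) + 1 / 4 * cosh (height p) * (h (fst p))\<^sup>2
        + 1 / 4 * (h (fst p))\<^sup>2 + 1 / 2 * (H (fst p))\<^sup>2
        + 1 / 2 * (cosh (height p / 2) * h (fst p))\<^sup>2)
          / (sinh (height p / 2) * h (fst p))\<^sup>2)"
  have "ricci (metric_g h H) p Y Z = (k - 1 / 2) * (coframe 1 p Y * coframe 1 p Z + coframe 2 p Y * coframe 2 p Z)
    - 3 / 2 * (coframe 3 p Y * coframe 3 p Z + coframe 4 p Y * coframe 4 p Z)" for Y Z
    unfolding cartan.ricci_frame[OF p curvature_equations[OF p] linear_curvature_form] sum_4
      curvature_form_def[OF p] k_def[symmetric] coframe_simps[symmetric] wedge11_def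
    by (simp add: coframe_frame[OF p] u2_matrix_simps field_simps)
  then have "ricci (metric_g h H) p Y Z =
      (k - 1 / 2) * (sinh (height p / 2) * h (fst p))\<^sup>2 * (dx Y * dx Z + dy Y * dy Z)
      - 3 / 2 * (theta3 H p Y * theta3 H p Z + theta4 H p Y * theta4 H p Z)" for Y Z
    by (simp add: coframe_simps base_form_def power2_eq_square field_simps)
  then show ?thesis by blast
qed

end

lemma kahler: "kahler_on M (metric_g h H) (complex_structure (- 1))"
  unfolding kahler_on_def using hermitian[of "- 1"] ext_deriv2_kahler_form[of _ "- 1"] by simp

lemma kahler_form_minus:
  "p \<in> M \<Longrightarrow> kahler_form (metric_g h H) (complex_structure (- 1)) p X Y = Omega_bar h H p X Y"
  unfolding kahler_form_eq[of "- 1", simplified]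
  by (cases p) (simp add: Omega_bar_def omega_Sigma_def sinh_half_sq_def base_form_def wedge11_def
      power2_eq_square algebra_simps)

lemma kahler_form_plus:
  "p \<in> M \<Longrightarrow> kahler_form (metric_g h H) (complex_structure 1) p X Y = Omega h H p X Y"
  unfolding kahler_form_eq[of 1, simplified]
  by (cases p) (simp add: Omega_def omega_Sigma_def sinh_half_sq_def base_form_def wedge11_def
      power2_eq_square algebra_simps)

lemma ricci_invariant: "ricci_invariant_on M (metric_g h H) (complex_structure 1)"
  unfolding ricci_invariant_on_def
proof (intro ballI allI)
  fix p X Y assume p: "p \<in> M"
  obtain r where r: "\<And>Y Z. ricci (metric_g h H) p Y Z = r * (dx Y * dx Z + dy Y * dy Z)
      - 3 / 2 * (theta3 H p Y * theta3 H p Z + theta4 H p Y * theta4 H p Z)"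
    using ricci_diagonal[OF p] by blast
  show "ricci (metric_g h H) p (complex_structure 1 p X) (complex_structure 1 p Y) =
    ricci (metric_g h H) p X Y"
    unfolding r forms_complex_structure[OF p] by (simp add: add.commute)
qed

text \<open>
Evaluated on the coordinate fields of \<open>t\<close> and \<open>y\<close> at \<open>t = 0\<close>, the term \<open>d(coth (z/2)) \<and> \<theta>\<^sub>4\<close> of
\<open>d\<theta>\<close> vanishes, since neither \<open>dz\<close> nor \<open>\<theta>\<^sub>4\<close> sees the first field, and \<open>\<tau> \<and> B\<close> has the value
\<open>H\<close>.
\<close>

lemma not_locally_conformally_kahler:
  assumes "U \<noteq> {}"
  shows "\<not> locally_conformally_kahler_on M (metric_g h H) (complex_structure 1)"
proof -
  obtain q where q: "q \<in> U" using assms by blast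
  define p :: "plane \<times> plane" where "p = (q, (- 1, 0))"
  have p: "p \<in> M" using q by (simp add: p_def half_plane_def)
  let ?\<theta> = "lee_form (metric_g h H) (complex_structure 1)"
  let ?f = "\<lambda>q. cosh (height q / 2) * inverse (sinh (height q / 2))"
  define X :: "plane \<times> plane" where "X = ((0, 0), (0, 1))"
  define Y :: "plane \<times> plane" where "Y = ((0, 1), (0, 0))"
  have "smooth_on M ?f"
    using sinh_half_neq by (intro smooth_intros smooth_on_inverse)
  then have f: "(?f has_derivative dir_deriv ?f p) (at p)"
    by (rule smooth_on_has_derivative[OF _ open_M p])
  have dz_only: "dir_deriv ?f p X = 0"
  proof -
    have "((\<lambda>q. inverse (sinh (height q / 2))) has_derivative
        (\<lambda>v. - (inverse (sinh (height p / 2)) * (1 / 2 * cosh (height p / 2) * dz v)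
          * inverse (sinh (height p / 2))))) (at p)"
      by (rule Deriv.has_derivative_inverse[OF sinh_half_neq[OF p] has_derivative_fiber(5)])
    from dir_deriv_eqI[OF has_derivative_mult[OF has_derivative_fiber(6) this]]
    show ?thesis by (simp add: X_def dz_def)
  qed
  have "ext_deriv1 ?\<theta> p X Y = ext_deriv1 (\<lambda>q X. ?f q * theta4 H q X) p X Y"
  proof (rule ext_deriv1_cong[OF open_M p])
    show "?\<theta> q V = ?f q * theta4 H q V" if "q \<in> M" for q V
      by (simp only: lee_form_eq[OF that] alpha_def split_beta divide_inverse minus_minus)
  qed
  also have "\<dots> = wedge11 (dir_deriv ?f p) (theta4 H p) X Y
      + ?f p * - wedge11 (angle_form H p) (rotated_y H p) X Y"
    by (rule has_ext_derivD(1)[OF has_ext_deriv_scale[OF f ext_theta4[OF p]]])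
  also have "\<dots> = - (?f p * H q)"
    using dz_only
    by (simp add: wedge11_def theta4_eq rotated_x_def rotated_y_def angle_form_def conj_dlog_def X_def Y_def
        p_def dx_def dy_def dz_def dt_def)
  also have "\<dots> \<noteq> 0"
    using H_pos[OF q] sinh_half_neq[OF p] cosh_real_pos[of "height p / 2"] by simp
  finally show ?thesis
    using p unfolding locally_conformally_kahler_on_def by blast
qed

end

theorem theorem3:
  fixes U :: "(real \<times> real) set"
    and h H :: "real \<times> real \<Rightarrow> real"
    and M :: "((real \<times> real) \<times> (real \<times> real)) set"
    and g :: "(real \<times> real) \<times> (real \<times> real) \<Rightarrow> (real \<times> real) \<times> (real \<times> real) \<Rightarrow>
              (real \<times> real) \<times> (real \<times> real) \<Rightarrow> real"
  assumes "open U" and "U \<noteq> {}"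
    and "smooth_on U h" and "\<And>q. q \<in> U \<Longrightarrow> 0 < h q"
    and "smooth_on U H" and "\<And>q. q \<in> U \<Longrightarrow> 0 < H q"
    and "\<And>q. q \<in> U \<Longrightarrow> flat_laplacian (\<lambda>q. ln (H q)) q = 1 / 2 * (h q)\<^sup>2 + (H q)\<^sup>2"
    and "M = U \<times> half_plane"
    and "g = metric_g h H"
  shows "\<exists>J_bar J.
      kahler_on M g J_bar \<and>
      (\<forall>p\<in>M. \<forall>X Y. kahler_form g J_bar p X Y = Omega_bar h H p X Y) \<and>
      hermitian_on M g J \<and>
      (\<forall>p\<in>M. \<forall>X Y. kahler_form g J p X Y = Omega h H p X Y) \<and>
      ricci_invariant_on M g J \<and>
      \<not> locally_conformally_kahler_on M g J \<and>
      (\<forall>p\<in>M. \<forall>X. lee_form g J p X = - alpha p * theta4 H p X)"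
proof -
  interpret metric_data U h H
    by unfold_locales (rule assms; assumption)+
  show ?thesis
    unfolding assms(8,9)
    using kahler kahler_form_minus hermitian[of 1] kahler_form_plus ricci_invariant
      not_locally_conformally_kahler[OF assms(2)] lee_form_eq
    by (intro exI[of _ "complex_structure (- 1)"] exI[of _ "complex_structure 1"]) simp
qed

end
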